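(* Let $\mathcal{K}\subset\mathbb{R}^{d+1}$ be the isotropic rescaling of Bizeul's convex body (defined in the context), and for $t>0$ let $(X_t,\Lambda_t)\in\mathbb{R}^d\times\mathbb{R}$ be distributed according to the probability measure $\mu_t$ on $\mathcal{K}$ with density proportional to $e^{-t(|x|^2+\lambda^2)}$. Then $\operatorname{Var}\Lambda_t\gtrsim d^{1/3}$ for $t\asymp d^{-1/3}$. Precisely, $$\operatorname{Var}\Lambda_t\gtrsim\begin{cases}t^2d&\text{if }d^{-1/2}\lesssim t\lesssim d^{-1/3},\\ t^{-1}&\text{if }d^{-1/3}\lesssim t\ll1.\end{cases}$$
   Context: For a sufficiently large universal constant $C_0>0$, let $$\mathcal{K}_0=\bigl([-\sqrt3,\sqrt3]^d\times\mathbb{R}\bigr)\cap\{(x,\lambda)\in\mathbb{R}^d\times\mathbb{R}:|x|\le\sqrt d+C_0(1-|\lambda|)\}.$$ By symmetry the uniform distribution $\pi$ on $\mathcal{K}_0$ has barycenter $0$ and covariance $\operatorname{diag}(aI_d,b)$ for some $a,b>0$. Let $D=\operatorname{diag}(a^{-1/2}I_d,b^{-1/2})$ and $\mathcal{K}=D\mathcal{K}_0$, so that the uniform distribution on $\mathcal{K}$ is isotropic (barycenter at $0$ and identity covariance). Here $|\cdot|$ is the Euclidean norm; $a\lesssim b$ means $a\le cb$ for a universal constant $c>0$, $\gtrsim$ and $\asymp$ are defined accordingly, and $t\ll1$ means $t$ is at most a sufficiently small universal constant. *)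

theory Defs
  imports "HOL-Probability.Probability"
begin

text \<open>
  The dimension has to be quantified after the universal constants, so \<open>\<real>\<^sup>d\<close> is modelled by the
  extensional functions \<open>{..<d} \<rightarrow>\<^sub>E UNIV\<close> with product Lebesgue measure, and the Euclidean norm
  of \<open>x\<close> is \<^term>\<open>L2_set x {..<d}\<close>.
\<close>

definition leb_prod :: "nat \<Rightarrow> ((nat \<Rightarrow> real) \<times> real) measure" where
  "leb_prod d = (\<Pi>\<^sub>M i\<in>{..<d}. (lborel :: real measure)) \<Otimes>\<^sub>M (lborel :: real measure)"

definition body0 :: "real \<Rightarrow> nat \<Rightarrow> ((nat \<Rightarrow> real) \<times> real) set" where
  "body0 C0 d = (({..<d} \<rightarrow>\<^sub>E {- sqrt 3..sqrt 3}) \<times> UNIV)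
     \<inter> {(x, l). L2_set x {..<d} \<le> sqrt (real d) + C0 * (1 - \<bar>l\<bar>)}"

definition unif0 :: "real \<Rightarrow> nat \<Rightarrow> ((nat \<Rightarrow> real) \<times> real) measure" where
  "unif0 C0 d = uniform_measure (leb_prod d) (body0 C0 d)"

text \<open>
  The body is invariant under sign changes and permutations of the coordinates of \<open>x\<close> and under
  \<open>l \<mapsto> - l\<close>. Hence the covariance matrix of \<^term>\<open>unif0 C0 d\<close> is diagonal and its first \<open>d\<close> diagonal
  entries agree; for \<open>d \<ge> 1\<close> their common value is the variance of the coordinate with index 0.
\<close>

definition var_x :: "real \<Rightarrow> nat \<Rightarrow> real" where
  "var_x C0 d = prob_space.variance (unif0 C0 d) (\<lambda>(x, l). x 0)"

definition var_l :: "real \<Rightarrow> nat \<Rightarrow> real" where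
  "var_l C0 d = prob_space.variance (unif0 C0 d) (\<lambda>(x, l). l)"

definition body :: "real \<Rightarrow> nat \<Rightarrow> ((nat \<Rightarrow> real) \<times> real) set" where
  "body C0 d = (\<lambda>(x, l). ((\<lambda>i\<in>{..<d}. x i / sqrt (var_x C0 d)), l / sqrt (var_l C0 d))) ` body0 C0 d"

definition gauss_weight :: "real \<Rightarrow> nat \<Rightarrow> real \<Rightarrow> (nat \<Rightarrow> real) \<times> real \<Rightarrow> ennreal" where
  "gauss_weight C0 d t = (\<lambda>(x, l). indicator (body C0 d) (x, l)
     * ennreal (exp (- t * ((L2_set x {..<d})\<^sup>2 + l\<^sup>2))))"

definition mu :: "real \<Rightarrow> nat \<Rightarrow> real \<Rightarrow> ((nat \<Rightarrow> real) \<times> real) measure" where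
  "mu C0 d t = density (leb_prod d)
     (\<lambda>p. gauss_weight C0 d t p / (\<integral>\<^sup>+ q. gauss_weight C0 d t q \<partial>leb_prod d))"

definition var_Lambda :: "real \<Rightarrow> nat \<Rightarrow> real \<Rightarrow> real" where
  "var_Lambda C0 d t = prob_space.variance (mu C0 d t) (\<lambda>(x, l). l)"

end

theory Submission
  imports Defs
begin

text \<open>
  Write \<open>a\<close> and \<open>b\<close> for the two variances of the uniform law. In the isotropic coordinates the tilted law has
  at height \<open>l\<close> the marginal density \<open>exp (- t l\<^sup>2) S(l)\<close>, up to normalisation, where \<open>S(l)\<close> is the mass
  that the product measure on the cube with density \<open>exp (- t |x|\<^sup>2)\<close> gives to the ball
  \<open>sqrt a |x| \<le> sqrt d + C0 (1 - sqrt b |l|)\<close>. For \<open>t = 0\<close> the norm \<open>sqrt a |x|\<close> is \<open>sqrt d + O(1)\<close>. The tilt lowers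
  the mean of \<open>a x\<^sub>i\<^sup>2\<close> from \<open>1\<close> to at most \<open>1 - q\<close> with \<open>q\<close> of order \<open>t\<close>, so \<open>sqrt a |x|\<close> drops by a multiple of
  \<open>t sqrt d\<close>, and the ball constraint typically starts to matter only at heights \<open>|l|\<close> of order \<open>t sqrt d\<close>.
  The factor \<open>exp (- t l\<^sup>2)\<close> is of order one up to \<open>|l| = 1 / sqrt t\<close>. The marginal is therefore comparable
  to a constant on \<open>[-R, R]\<close>, where \<open>R\<close> is a small multiple of the smaller of these two heights.

  A symmetric density with values between \<open>z / 6\<close> and \<open>z\<close> on \<open>[-R, R]\<close> has variance at least
  \<open>R\<^sup>2 / 18\<close>, whatever its tails are (\<open>plateau_variance\<close>). This gives
  \<open>Var \<ge> c min (t\<^sup>2 d) (1 / t)\<close> for \<open>t\<close> in a bounded interval (\<open>var_Lambda_ge_min\<close>), and the three regimes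
  are read off by comparing \<open>t\<^sup>3 d\<close> with a constant.

  The plateau comes from an exponential moment bound for sums over the cube with exponent \<open>1 / sqrt d\<close>
  (\<open>product_chernoff\<close>) together with the drop of the second moment (\<open>tilted_second_moment\<close>). About the
  rescaling only \<open>0 < a \<le> 3\<close> and \<open>0 < b \<le> B\<close> enter, with \<open>B\<close> depending on \<open>C0\<close> but not on \<open>d\<close>. The first is
  immediate, since \<open>x\<^sub>i\<^sup>2 \<le> 3\<close> on the body; the second is the exponential decay of the slices of the
  body (\<open>uniform_slice_le\<close>), again from \<open>product_chernoff\<close>.
\<close>

section \<open>Exponential moments of sums over a product measure\<close>

text \<open>
  Hoeffding's lemma for the law with density proportional to \<open>w\<close>. The unnormalised form is the one that
  can be multiplied over the coordinates; a negative mean only helps because \<open>\<theta>\<close> is positive.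
\<close>

lemma mgf_le_of_mean_nonpos:
  fixes w f :: "'a \<Rightarrow> real"
  assumes [measurable]: "w \<in> borel_measurable M" "f \<in> borel_measurable M"
    and w: "\<And>x. 0 \<le> w x" "integrable M w" "0 < integral\<^sup>L M w"
    and f: "\<And>x. w x \<noteq> 0 \<Longrightarrow> f x \<in> {m..m + r}"
    and mean: "(\<integral>x. w x * f x \<partial>M) \<le> 0" and "0 < \<theta>"
  shows "(\<integral>\<^sup>+x. ennreal (w x * exp (\<theta> * f x)) \<partial>M)
      \<le> ennreal (exp (\<theta>\<^sup>2 * r\<^sup>2 / 8)) * (\<integral>\<^sup>+x. ennreal (w x) \<partial>M)"
proof -
  define I where "I = integral\<^sup>L M w"
  have I: "0 < I" "(\<integral>\<^sup>+x. ennreal (w x) \<partial>M) = ennreal I"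
    using w by (auto simp: I_def nn_integral_eq_integral)
  define N where "N = density M (\<lambda>x. ennreal (w x / I))"
  have ae: "AE x in N. f x \<in> {m..m + r}"
    unfolding N_def using f I by (subst AE_density) (auto simp: ennreal_eq_0_iff zero_less_divide_iff)
  have "emeasure N (space N) = (\<integral>\<^sup>+x. ennreal (w x / I) \<partial>M)"
    unfolding N_def by (subst emeasure_density) (auto intro!: nn_integral_cong)
  also have "\<dots> = (\<integral>\<^sup>+x. ennreal (w x) * ennreal (1 / I) \<partial>M)"
    using I w by (intro nn_integral_cong) (simp add: ennreal_mult'[symmetric])
  also have "\<dots> = 1"
    using I by (simp add: nn_integral_multc ennreal_mult'[symmetric])
  finally interpret N: prob_space N by (rule prob_spaceI)
  have "f \<in> borel_measurable N" by (simp add: N_def)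
  then interpret N: interval_bounded_random_variable N f m "m + r"
    using ae by unfold_locales
  define e where "e = N.expectation f"
  have "e = (\<integral>x. w x / I * f x \<partial>M)"
    unfolding e_def N_def using w I by (subst integral_density) auto
  also have "\<dots> = (\<integral>x. w x * f x \<partial>M) / I"
    by (simp add: integral_divide_zero[symmetric] del: integral_divide_zero)
  finally have e: "e \<le> 0"
    using mean I by (simp add: divide_le_0_iff)
  have "(\<integral>\<^sup>+x. ennreal (w x * exp (\<theta> * f x)) \<partial>M)
      = (\<integral>\<^sup>+x. ennreal I * (ennreal (w x / I) * ennreal (exp (\<theta> * f x))) \<partial>M)"
    using w I by (intro nn_integral_cong) (simp add: ennreal_mult'[symmetric])
  also have "\<dots> = ennreal I * (\<integral>\<^sup>+x. ennreal (exp (\<theta> * f x)) \<partial>N)"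
    unfolding N_def by (subst nn_integral_density) (auto simp: nn_integral_cmult)
  also have "(\<integral>\<^sup>+x. ennreal (exp (\<theta> * f x)) \<partial>N) \<le> (\<integral>\<^sup>+x. ennreal (exp (\<theta> * (f x - e))) \<partial>N)"
    using e \<open>0 < \<theta>\<close> by (intro nn_integral_mono) (auto intro!: ennreal_leI)
  also have "\<dots> \<le> ennreal (exp (\<theta>\<^sup>2 * r\<^sup>2 / 8))"
    using N.Hoeffdings_lemma_nn_integral[OF \<open>0 < \<theta>\<close>] by (simp add: e_def)
  finally show ?thesis
    by (simp add: I mult.commute mult_right_mono)
qed

text \<open>
  Markov's inequality for \<open>exp (\<theta> (\<Sum>i<d. f (x i)))\<close>, which factorises over the coordinates. With \<open>\<theta> = 1 / sqrt d\<close>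
  the \<open>d\<close> Hoeffding factors \<open>exp (9 \<theta>\<^sup>2 / 8)\<close> multiply to a constant. The range of \<open>f\<close> has length \<open>3\<close> because
  the functions of interest are \<open>\<plusminus> y\<^sup>2\<close> on the interval where \<open>y\<^sup>2 \<le> 3\<close>, up to shifts and scaling.
\<close>

lemma product_chernoff:
  fixes w f :: "real \<Rightarrow> real"
  assumes [measurable]: "w \<in> borel_measurable borel" "f \<in> borel_measurable borel"
    and w: "\<And>x. 0 \<le> w x" "integrable lborel w" "0 < integral\<^sup>L lborel w"
    and f: "\<And>x. w x \<noteq> 0 \<Longrightarrow> f x \<in> {m..m + 3}"
    and mean: "(\<integral>x. w x * f x \<partial>lborel) \<le> 0" and d: "1 \<le> d"
  shows "(\<integral>\<^sup>+x. ennreal (\<Prod>i<d. w (x i)) * indicator {x. u * sqrt (real d) \<le> (\<Sum>i<d. f (x i))} x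
            \<partial>(\<Pi>\<^sub>M i\<in>{..<d}. lborel))
      \<le> ennreal (exp (9 / 8 - u)) * (\<integral>\<^sup>+y. ennreal (w y) \<partial>lborel) ^ d"
proof -
  interpret product_sigma_finite "\<lambda>_::nat. lborel :: real measure" ..
  define \<theta> where "\<theta> = 1 / sqrt (real d)"
  have \<theta>: "0 < \<theta>" "\<theta>\<^sup>2 * real d = 1" "\<theta> * sqrt (real d) = 1"
    using d by (auto simp: \<theta>_def power_divide)
  have "(\<integral>\<^sup>+x. ennreal (\<Prod>i<d. w (x i)) * indicator {x. u * sqrt (real d) \<le> (\<Sum>i<d. f (x i))} x
            \<partial>(\<Pi>\<^sub>M i\<in>{..<d}. lborel))
     \<le> (\<integral>\<^sup>+x. ennreal (exp (- u)) * (\<Prod>i<d. ennreal (w (x i) * exp (\<theta> * f (x i))))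
            \<partial>(\<Pi>\<^sub>M i\<in>{..<d}. lborel))"
  proof (intro nn_integral_mono)
    fix x :: "nat \<Rightarrow> real"
    have *: "(\<Prod>i<d. w (x i)) \<le> exp (- u) * (\<Prod>i<d. w (x i) * exp (\<theta> * f (x i)))"
      if "u * sqrt (real d) \<le> (\<Sum>i<d. f (x i))"
    proof -
      have "u = \<theta> * (u * sqrt (real d))" using \<theta>(3) by (simp add: mult.left_commute)
      also have "\<dots> \<le> \<theta> * (\<Sum>i<d. f (x i))" using that \<theta> by (intro mult_left_mono) auto
      finally have "1 \<le> exp (- u) * exp (\<theta> * (\<Sum>i<d. f (x i)))"
        by (simp flip: exp_add)
      then have "(\<Prod>i<d. w (x i)) * 1 \<le> (\<Prod>i<d. w (x i)) * (exp (- u) * exp (\<theta> * (\<Sum>i<d. f (x i))))"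
        using w by (intro mult_left_mono prod_nonneg) auto
      then show ?thesis
        by (simp add: prod.distrib exp_sum sum_distrib_left mult_ac)
    qed
    show "ennreal (\<Prod>i<d. w (x i)) * indicator {x. u * sqrt (real d) \<le> (\<Sum>i<d. f (x i))} x
        \<le> ennreal (exp (- u)) * (\<Prod>i<d. ennreal (w (x i) * exp (\<theta> * f (x i))))"
      using * w by (auto split: split_indicator simp: prod_ennreal ennreal_mult'[symmetric] intro!: ennreal_leI)
  qed
  also have "\<dots> = ennreal (exp (- u)) * (\<integral>\<^sup>+y. ennreal (w y * exp (\<theta> * f y)) \<partial>lborel) ^ d"
    by (subst nn_integral_cmult, measurable)
       (subst product_nn_integral_prod, auto)
  also have "\<dots> \<le> ennreal (exp (- u)) *
      (ennreal (exp (\<theta>\<^sup>2 * 3\<^sup>2 / 8)) * (\<integral>\<^sup>+y. ennreal (w y) \<partial>lborel)) ^ d"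
    by (intro mult_left_mono power_mono mgf_le_of_mean_nonpos[OF _ _ w f mean \<theta>(1)]) auto
  also have "\<dots> = ennreal (exp (9 / 8 - u)) * (\<integral>\<^sup>+y. ennreal (w y) \<partial>lborel) ^ d"
  proof -
    have "exp (- u) * exp (\<theta>\<^sup>2 * 3\<^sup>2 / 8) ^ d = exp (9 / 8 - u)"
      using \<theta>(2) by (simp flip: exp_of_nat_mult exp_add) (simp add: algebra_simps)
    then show ?thesis
      by (simp add: power_mult_distrib ennreal_power ennreal_mult'[symmetric] mult.assoc[symmetric])
  qed
  finally show ?thesis .
qed

section \<open>The tilted edge of the cube\<close>

definition cube_weight :: "real \<Rightarrow> real \<Rightarrow> real \<Rightarrow> real" where
  "cube_weight a t y = indicator {y. a * y\<^sup>2 \<le> 3} y * exp (- t * y\<^sup>2)"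

lemma cube_weight_measurable[measurable]: "cube_weight a t \<in> borel_measurable borel"
  unfolding cube_weight_def by measurable

lemma cube_weight_nonneg: "0 \<le> cube_weight a t y"
  by (simp add: cube_weight_def)

lemma edge_interval:
  assumes "0 < a"
  shows "{y::real. a * y\<^sup>2 \<le> 3} = {- sqrt (3 / a)..sqrt (3 / a)}"
proof -
  have "a * y\<^sup>2 \<le> 3 \<longleftrightarrow> \<bar>y\<bar> \<le> sqrt (3 / a)" for y
  proof -
    have "a * y\<^sup>2 \<le> 3 \<longleftrightarrow> y\<^sup>2 \<le> 3 / a"
      using assms by (simp add: field_simps)
    also have "\<dots> \<longleftrightarrow> sqrt (y\<^sup>2) \<le> sqrt (3 / a)" by (simp only: real_sqrt_le_iff)
    finally show ?thesis by simp
  qed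
  then show ?thesis
    unfolding set_eq_iff mem_Collect_eq atLeastAtMost_iff abs_le_iff by (metis minus_le_iff)
qed

lemma cube_weight_integrable:
  assumes "0 < a" and g: "continuous_on UNIV g"
  shows "integrable lborel (\<lambda>y. cube_weight a t y * g y)"
proof -
  have "integrable lborel (\<lambda>y. indicator {- sqrt (3 / a)..sqrt (3 / a)} y *\<^sub>R (exp (- t * y\<^sup>2) * g y))"
    using continuous_on_subset[OF g]
    by (intro borel_integrable_atLeastAtMost'[unfolded set_integrable_def] continuous_intros) auto
  then show ?thesis
    by (simp add: cube_weight_def edge_interval[OF assms(1)] mult.assoc)
qed

lemma cube_weight_integral_pos:
  assumes "0 < a"
  shows "0 < integral\<^sup>L lborel (cube_weight a t)"
proof -
  have "emeasure lborel {y. a * y\<^sup>2 \<le> 3} \<noteq> 0"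
    using assms by (subst edge_interval) auto
  moreover have "integrable lborel (cube_weight a t)"
    using cube_weight_integrable[OF assms, of "\<lambda>_. 1"] by simp
  moreover have "AE y in lborel. y \<notin> {y. a * y\<^sup>2 \<le> 3}"
    if "integral\<^sup>L lborel (cube_weight a t) = 0"
    using that \<open>integrable lborel (cube_weight a t)\<close>
    by (subst (asm) integral_nonneg_eq_0_iff_AE)
       (auto simp: cube_weight_nonneg cube_weight_def indicator_def elim!: eventually_mono split: if_splits)
  moreover have "emeasure lborel {y. a * y\<^sup>2 \<le> 3} = 0" if "AE y in lborel. y \<notin> {y. a * y\<^sup>2 \<le> 3}"
    using that by (subst (asm) AE_iff_measurable[OF _ refl]) auto
  moreover have "0 \<le> integral\<^sup>L lborel (cube_weight a t)"
    by (intro integral_nonneg_AE) (auto simp: cube_weight_nonneg)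
  ultimately show ?thesis
    by (metis order_le_less)
qed

text \<open>
  Put \<open>z = 1 - a y\<^sup>2\<close>, which has mean zero for the uniform law on the edge. The weight is proportional to
  \<open>exp (s z)\<close> with \<open>s = t / a\<close>, so tilting favours large \<open>z\<close>, and to first order the mean of \<open>z\<close> becomes \<open>s\<close>
  times its uniform variance \<open>4 / 5\<close>. As \<open>s\<close> is at least \<open>t / 3\<close> but can be arbitrarily large when \<open>a\<close> is
  small, the expansion is made at \<open>t / 3\<close> and then transferred to larger \<open>s\<close>: the mean of \<open>z\<close> under
  \<open>exp (s z)\<close> increases with \<open>s\<close>.
\<close>

lemma tilted_second_moment:
  assumes a: "0 < a" "a \<le> 3" and t: "0 \<le> t" "t \<le> T" and q: "q = 4 / 15 * exp (- T) * t"
  shows "(\<integral>y. cube_weight a t y * (a * y\<^sup>2 - (1 - q)) \<partial>lborel) \<le> 0"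
proof -
  define h where "h = sqrt (3 / a)"
  have h: "0 < h" "a * h\<^sup>2 = 3" using a by (simp_all add: h_def)
  define s where "s = t / 3"
  define C where "C = exp (- (t / a)) * exp ((t / a - s) * q)"
  define c where "c = s * exp (- 2 * s)"
  define p where "p y = q * exp s - (1 - a * y\<^sup>2) - c * (1 - a * y\<^sup>2)\<^sup>2" for y
  have s: "0 \<le> s" "s \<le> t / a" using a t divide_left_mono[of a 3 t] by (auto simp: s_def)
  have edge: "indicator {-h..h} y = (if a * y\<^sup>2 \<le> 3 then 1 else 0 :: real)" for y
    unfolding h_def edge_interval[OF a(1), symmetric] by (simp add: indicator_def)
  have q0: "0 \<le> q" unfolding q using t by simp
  \<comment> \<open>Both parts of the argument are pointwise inequalities; together they bound the integrand
    by a multiple of a polynomial \<open>p\<close>, which can be integrated explicitly.\<close>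
  have pointwise: "cube_weight a t y * (a * y\<^sup>2 - (1 - q)) \<le> C * (p y * indicator {-h..h} y)" for y
  proof (cases "a * y\<^sup>2 \<le> 3")
    case False
    then show ?thesis by (simp add: cube_weight_def edge)
  next
    case True
    define z where "z = 1 - a * y\<^sup>2"
    have z: "-2 \<le> z" "z \<le> 1" using True a by (auto simp: z_def)
    have ew: "exp (- t * y\<^sup>2) = exp (- (t / a)) * exp ((t / a) * z)"
      using a by (simp add: z_def algebra_simps flip: exp_add)
    \<comment> \<open>Monotonicity in \<open>s\<close>: the extra factor \<open>exp ((t / a - s) z)\<close> lies on the favourable side of its
      value at \<open>z = q\<close>, the point where \<open>q - z\<close> changes sign.\<close>
    have 1: "(q - z) * exp ((t / a) * z) \<le> exp ((t / a - s) * q) * ((q - z) * exp (s * z))"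
    proof -
      have "(q - z) * exp ((t / a - s) * z) \<le> (q - z) * exp ((t / a - s) * q)"
      proof (cases "z \<le> q")
        case True
        then have "exp ((t / a - s) * z) \<le> exp ((t / a - s) * q)"
          using mult_left_mono[of z q "t / a - s"] s by simp
        then show ?thesis using True by (intro mult_left_mono) auto
      next
        case False
        then have "exp ((t / a - s) * q) \<le> exp ((t / a - s) * z)"
          using mult_left_mono[of q z "t / a - s"] s by simp
        then show ?thesis using False by (intro mult_left_mono_neg) auto
      qed
      then have "(q - z) * exp ((t / a - s) * z) * exp (s * z) \<le> (q - z) * exp ((t / a - s) * q) * exp (s * z)"
        by (intro mult_right_mono) auto
      then show ?thesis by (simp add: algebra_simps flip: exp_add)
    qed
    \<comment> \<open>First order expansion at \<open>s = t / 3\<close>; the factor \<open>exp (- 2 s)\<close> in \<open>c\<close> is the least value of \<open>exp (s z)\<close>.\<close>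
    have 2: "(q - z) * exp (s * z) \<le> p y"
    proof -
      have "z + c * z\<^sup>2 \<le> z * exp (s * z)"
      proof (cases "0 \<le> z")
        case True
        have "c \<le> s" using s by (auto simp: c_def intro: mult_left_le)
        then have "c * z\<^sup>2 \<le> s * z\<^sup>2" by (intro mult_right_mono) auto
        moreover have "z * (1 + s * z) \<le> z * exp (s * z)" using True by (intro mult_left_mono) auto
        ultimately show ?thesis by (simp add: algebra_simps power2_eq_square)
      next
        case False
        have "c * (- z) = (s * exp (- 2 * s)) * (- z)" by (simp add: c_def)
        also have "\<dots> \<le> s * exp (s * z) * (- z)"
          using z s False mult_left_mono[of "-2" z s] by (intro mult_right_mono mult_left_mono) (auto simp: mult.commute)
        also have "\<dots> = (- s * z) * exp (s * z)" by simp
        also have "\<dots> \<le> (exp (- s * z) - 1) * exp (s * z)"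
          using exp_ge_add_one_self[of "- s * z"] by (intro mult_right_mono) auto
        also have "\<dots> = 1 - exp (s * z)" by (simp add: algebra_simps flip: exp_add)
        finally have "(- z) * (c * (- z)) \<le> (- z) * (1 - exp (s * z))" using False by (intro mult_left_mono) auto
        then show ?thesis by (simp add: algebra_simps power2_eq_square)
      qed
      moreover have "q * exp (s * z) \<le> q * exp s"
        using q0 s z by (intro mult_left_mono) (auto intro: mult_left_le)
      ultimately show ?thesis by (simp add: p_def z_def[symmetric] left_diff_distrib)
    qed
    have "cube_weight a t y * (a * y\<^sup>2 - (1 - q)) = exp (- (t / a)) * ((q - z) * exp ((t / a) * z))"
    proof -
      have "a * y\<^sup>2 - (1 - q) = q - z" by (simp add: z_def)
      moreover have "cube_weight a t y = exp (- t * y\<^sup>2)" using True by (simp add: cube_weight_def)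
      ultimately show ?thesis unfolding ew by (simp only: mult_ac)
    qed
    also have "\<dots> \<le> exp (- (t / a)) * (exp ((t / a - s) * q) * p y)"
      using 1 2 by (intro mult_left_mono order.trans[OF 1]) auto
    finally show ?thesis using True by (simp add: C_def edge)
  qed
  define F where "F y = q * exp s * y - (y - a * y^3 / 3) - c * (y - 2 * a * y^3 / 3 + a\<^sup>2 * y^5 / 5)" for y
  have "has_bochner_integral lborel (\<lambda>y. p y * indicator {-h..h} y) (F h - F (- h))"
  proof (rule has_bochner_integral_FTC_Icc_real)
    show "(F has_real_derivative p y) (at y)" for y
      unfolding F_def p_def
      by (auto intro!: derivative_eq_intros simp: field_simps eval_nat_numeral)
    show "isCont p y" for y unfolding p_def by (intro continuous_intros)
  qed (use h in auto)
  then have int: "integrable lborel (\<lambda>y. p y * indicator {-h..h} y)"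
      "(\<integral>y. p y * indicator {-h..h} y \<partial>lborel) = F h - F (- h)"
    by (auto simp: has_bochner_integral_iff)
  have "a * h ^ 3 = 3 * h" "a\<^sup>2 * h ^ 5 = 9 * h"
  proof -
    have "a * h ^ 3 = (a * h\<^sup>2) * h" "a\<^sup>2 * h ^ 5 = (a * h\<^sup>2) * (a * h\<^sup>2) * h" by (simp_all add: eval_nat_numeral)
    then show "a * h ^ 3 = 3 * h" "a\<^sup>2 * h ^ 5 = 9 * h" by (simp_all add: h)
  qed
  then have "F h - F (- h) = 2 * h * (q * exp s - 4 / 5 * c)"
    by (simp add: F_def algebra_simps)
  also have "q * exp s \<le> 4 / 5 * c"
  proof -
    have "exp (- T) * exp s \<le> exp (- 2 * s)"
      using t by (simp add: s_def flip: exp_add)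
    then have "4 / 15 * t * (exp (- T) * exp s) \<le> 4 / 15 * t * exp (- 2 * s)"
      using t by (intro mult_left_mono) auto
    then show ?thesis by (simp add: c_def q s_def)
  qed
  then have "2 * h * (q * exp s - 4 / 5 * c) \<le> 0" using h by (simp add: mult_le_0_iff)
  finally have F: "F h - F (- h) \<le> 0" .
  have "(\<integral>y. cube_weight a t y * (a * y\<^sup>2 - (1 - q)) \<partial>lborel)
      \<le> (\<integral>y. C * (p y * indicator {-h..h} y) \<partial>lborel)"
    using int by (intro integral_mono pointwise cube_weight_integrable a) (auto intro!: continuous_intros)
  also have "\<dots> \<le> 0" using F int by (simp add: C_def mult_le_0_iff)
  finally show ?thesis .
qed

section \<open>Slices of the body at a fixed height\<close>

abbreviation leb_space :: "nat \<Rightarrow> (nat \<Rightarrow> real) measure" where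
  "leb_space d \<equiv> \<Pi>\<^sub>M i\<in>{..<d}. lborel"

definition cube_mass :: "nat \<Rightarrow> real \<Rightarrow> real \<Rightarrow> real" where
  "cube_mass d a t = integral\<^sup>L lborel (cube_weight a t) ^ d"

text \<open>
  The mass of the slice at height \<open>l\<close> of the body rescaled by \<open>1 / sqrt a\<close> in the first \<open>d\<close> coordinates and by
  \<open>1 / sqrt b\<close> in the last one, under the product of the tilted edges. The constraint is left in terms of
  \<open>sqrt b |l|\<close>, which makes a change of variables unnecessary; \<open>a = b = 1\<close> and \<open>t = 0\<close> give the slices of
  the original body.
\<close>

definition slice :: "real \<Rightarrow> nat \<Rightarrow> real \<Rightarrow> real \<Rightarrow> real \<Rightarrow> real \<Rightarrow> ennreal" where
  "slice C0 d a b t l = (\<integral>\<^sup>+x. ennreal (\<Prod>i<d. cube_weight a t (x i))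
     * indicator {x. sqrt a * L2_set x {..<d} \<le> sqrt (real d) + C0 * (1 - sqrt b * \<bar>l\<bar>)} x \<partial>leb_space d)"

lemma cube_mass_pos: "0 < a \<Longrightarrow> 0 < cube_mass d a t"
  by (simp add: cube_mass_def cube_weight_integral_pos)

lemma cube_weight_nn_integral:
  assumes "0 < a"
  shows "(\<integral>\<^sup>+y. ennreal (cube_weight a t y) \<partial>lborel) ^ d = ennreal (cube_mass d a t)"
proof -
  have "integrable lborel (cube_weight a t)"
    using cube_weight_integrable[OF assms, of "\<lambda>_. 1"] by simp
  then show ?thesis
    using cube_weight_integral_pos[OF assms, of t]
    by (simp add: nn_integral_eq_integral cube_weight_nonneg cube_mass_def ennreal_power)
qed

lemma cube_nn_integral:
  assumes "0 < a"
  shows "(\<integral>\<^sup>+x. ennreal (\<Prod>i<d. cube_weight a t (x i)) \<partial>leb_space d) = ennreal (cube_mass d a t)"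
proof -
  interpret product_sigma_finite "\<lambda>_::nat. lborel :: real measure" ..
  have "(\<integral>\<^sup>+x. ennreal (\<Prod>i<d. cube_weight a t (x i)) \<partial>leb_space d)
      = (\<integral>\<^sup>+x. (\<Prod>i<d. ennreal (cube_weight a t (x i))) \<partial>leb_space d)"
    by (simp add: prod_ennreal cube_weight_nonneg)
  also have "\<dots> = (\<integral>\<^sup>+y. ennreal (cube_weight a t y) \<partial>lborel) ^ d"
    by (subst product_nn_integral_prod) auto
  finally show ?thesis using cube_weight_nn_integral[OF assms] by simp
qed

lemma L2_set_measurable[measurable]: "(\<lambda>x. L2_set x {..<d}) \<in> borel_measurable (leb_space d)"
  unfolding L2_set_def by measurable

lemma sigma_finite_leb_space: "sigma_finite_measure (leb_space d)"
proof -
  interpret product_sigma_finite "\<lambda>_::nat. lborel :: real measure" ..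
  show ?thesis by (rule sigma_finite) simp
qed

lemma slice_measurable[measurable]: "slice C0 d a b t \<in> borel_measurable borel"
proof -
  interpret sigma_finite_measure "leb_space d" by (rule sigma_finite_leb_space)
  show ?thesis unfolding slice_def by measurable
qed

lemma slice_le:
  assumes "0 < a"
  shows "slice C0 d a b t l \<le> ennreal (cube_mass d a t)"
  unfolding slice_def cube_nn_integral[OF assms, symmetric]
  by (intro nn_integral_mono) (auto split: split_indicator)

lemma slice_uminus: "slice C0 d a b t (- l) = slice C0 d a b t l"
  by (simp add: slice_def)

lemma slice_eq_0:
  assumes "0 \<le> a" "sqrt (real d) + C0 * (1 - sqrt b * \<bar>l\<bar>) < 0"
  shows "slice C0 d a b t l = 0"
proof -
  have "\<not> sqrt a * L2_set x {..<d} \<le> sqrt (real d) + C0 * (1 - sqrt b * \<bar>l\<bar>)" for x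
    using assms mult_nonneg_nonneg[of "sqrt a" "L2_set x {..<d}"] L2_set_nonneg[of x "{..<d}"] real_sqrt_ge_zero[of a] by linarith
  then show ?thesis unfolding slice_def by simp
qed

lemma L2_set_sqrt_power2:
  assumes "0 \<le> a"
  shows "(sqrt a * L2_set x {..<d})\<^sup>2 = (\<Sum>i<d. a * (x i)\<^sup>2)"
  using assms by (simp add: L2_set_def power_mult_distrib sum_nonneg sum_distrib_left)

text \<open>
  A point outside the ball of radius \<open>\<rho>\<close> has \<open>(\<Sum>i<d. a x\<^sub>i\<^sup>2)\<close> at least \<open>3 sqrt d\<close> above \<open>d (1 - q)\<close>, an upper bound
  of its mean, and by the Chernoff bound such points carry at most the fraction \<open>exp (9 / 8 - 3) \<le> 1 / 2\<close> of
  the mass.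
\<close>

lemma slice_ge_half:
  assumes a: "0 < a" and d: "1 \<le> d"
    and mean: "(\<integral>y. cube_weight a t y * (a * y\<^sup>2 - (1 - q)) \<partial>lborel) \<le> 0"
    and \<rho>: "\<rho> = sqrt (real d) + C0 * (1 - sqrt b * \<bar>l\<bar>)" "0 \<le> \<rho>"
      "real d * (1 - q) + 3 * sqrt (real d) \<le> \<rho>\<^sup>2"
  shows "ennreal (cube_mass d a t / 2) \<le> slice C0 d a b t l"
proof -
  define Z where "Z = cube_mass d a t"
  have Z: "0 < Z" unfolding Z_def using a by (rule cube_mass_pos)
  define f where "f y = a * y\<^sup>2 - (1 - q)" for y :: real
  have [measurable]: "f \<in> borel_measurable borel" unfolding f_def by measurable
  let ?A = "{x. sqrt a * L2_set x {..<d} \<le> sqrt (real d) + C0 * (1 - sqrt b * \<bar>l\<bar>)}"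
  let ?B = "{x. 3 * sqrt (real d) \<le> (\<Sum>i<d. f (x i))}"
  let ?w = "\<lambda>x. ennreal (\<Prod>i<d. cube_weight a t (x i))"
  have cover: "x \<in> ?B" if "x \<notin> ?A" for x
  proof -
    have "\<rho> \<le> sqrt a * L2_set x {..<d}" using that \<rho>(1) by auto
    then have "\<rho>\<^sup>2 \<le> (sqrt a * L2_set x {..<d})\<^sup>2" using \<rho>(2) by (rule power_mono)
    also have "\<dots> = (\<Sum>i<d. a * (x i)\<^sup>2)" using a by (intro L2_set_sqrt_power2) simp
    also have "\<dots> = (\<Sum>i<d. f (x i)) + real d * (1 - q)"
      by (simp add: f_def sum_subtractf)
    finally show ?thesis using \<rho>(3) by simp
  qed
  have "ennreal Z = (\<integral>\<^sup>+x. ?w x \<partial>leb_space d)"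
    unfolding Z_def using cube_nn_integral[OF a] by simp
  also have "\<dots> \<le> (\<integral>\<^sup>+x. ?w x * indicator ?A x + ?w x * indicator ?B x \<partial>leb_space d)"
    using cover by (intro nn_integral_mono) (auto split: split_indicator)
  also have "\<dots> = slice C0 d a b t l + (\<integral>\<^sup>+x. ?w x * indicator ?B x \<partial>leb_space d)"
    unfolding slice_def by (subst nn_integral_add) auto
  also have "(\<integral>\<^sup>+x. ?w x * indicator ?B x \<partial>leb_space d) \<le> ennreal (exp (9 / 8 - 3)) * ennreal Z"
    unfolding Z_def cube_weight_nn_integral[OF a, symmetric]
  proof (rule product_chernoff[where m = "- (1 - q)"])
    show "integrable lborel (cube_weight a t)"
      using cube_weight_integrable[OF a, of "\<lambda>_. 1"] by simp
    show "f y \<in> {- (1 - q)..- (1 - q) + 3}" if "cube_weight a t y \<noteq> 0" for y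
      using that a by (auto simp: cube_weight_def f_def split: split_indicator_asm)
    show "(\<integral>y. cube_weight a t y * f y \<partial>lborel) \<le> 0" using mean by (simp add: f_def)
  qed (use a d in \<open>auto simp: cube_weight_nonneg cube_weight_integral_pos\<close>)
  also have "\<dots> = ennreal (exp (9 / 8 - 3) * Z)"
    by (simp add: ennreal_mult')
  also have "\<dots> \<le> ennreal (Z / 2)"
  proof (intro ennreal_leI)
    have "2 \<le> exp (15 / 8 :: real)" using exp_ge_add_one_self[of "15 / 8"] by simp
    then have "exp (- (15 / 8)) \<le> 1 / (2::real)" by (simp add: exp_minus field_simps)
    then have "exp (- (15 / 8)) * Z \<le> 1 / 2 * Z" using Z by (intro mult_right_mono) auto
    then show "exp (9 / 8 - 3) * Z \<le> Z / 2" by simp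
  qed
  finally have le: "ennreal Z \<le> slice C0 d a b t l + ennreal (Z / 2)"
    by (simp add: add_left_mono)
  have "ennreal Z = ennreal (Z / 2) + ennreal (Z / 2)"
    using Z by (subst ennreal_plus[symmetric]) auto
  then show ?thesis
    using le unfolding Z_def[symmetric] by (simp add: add.commute)
qed

lemma cube_weight_uniform_mean: "(\<integral>y. cube_weight 1 0 y * (1 - y\<^sup>2) \<partial>lborel) = 0"
proof -
  have "(\<integral>y. (1 - y\<^sup>2) * indicator {- sqrt 3..sqrt 3} y \<partial>lborel)
      = (sqrt 3 - sqrt 3 ^ 3 / 3) - (- sqrt 3 - (- sqrt 3) ^ 3 / 3)"
  proof (rule integral_FTC_Icc_real)
    show "((\<lambda>y. y - y ^ 3 / 3) has_real_derivative 1 - y\<^sup>2) (at y)" for y :: real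
      by (auto intro!: derivative_eq_intros)
  qed auto
  then show ?thesis
    using edge_interval[of 1] by (simp add: cube_weight_def mult.commute power3_eq_cube)
qed

text \<open>
  At height \<open>|l| = 1 + v / C0\<close> the ball has radius \<open>sqrt d - v\<close>, and points in it have \<open>(\<Sum>i<d. x\<^sub>i\<^sup>2)\<close> at least
  \<open>v sqrt d\<close> below its mean \<open>d\<close>. This decay in \<open>|l|\<close>, uniform in \<open>d\<close>, keeps the axial variance of the uniform
  law bounded.
\<close>

lemma uniform_slice_le:
  assumes d: "1 \<le> d" and C0: "1 \<le> C0"
  shows "slice C0 d 1 1 0 l \<le> ennreal (exp (9 / 8 + C0 - \<bar>l\<bar>) * cube_mass d 1 0)"
proof -
  define Z where "Z = cube_mass d 1 0"
  have Z: "0 < Z" unfolding Z_def by (rule cube_mass_pos) simp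
  define v where "v = C0 * (\<bar>l\<bar> - 1)"
  show ?thesis
  proof (cases "\<bar>l\<bar> \<le> 1")
    case True
    then have "Z \<le> exp (9 / 8 + C0 - \<bar>l\<bar>) * Z" using Z C0 by simp
    then show ?thesis
      using slice_le[of 1 C0 d 1 0 l] unfolding Z_def by (meson ennreal_leI order_trans zero_less_one)
  next
    case False
    then have "0 \<le> \<bar>l\<bar> - 1" by simp
    then have "1 * (\<bar>l\<bar> - 1) \<le> v" unfolding v_def using C0 by (intro mult_right_mono) auto
    then have v: "0 \<le> v" "- v \<le> C0 - \<bar>l\<bar>"
      using \<open>0 \<le> \<bar>l\<bar> - 1\<close> C0 by auto
    have sub: "v * sqrt (real d) \<le> (\<Sum>i<d. 1 - (x i)\<^sup>2)" if "L2_set x {..<d} \<le> sqrt (real d) - v" for x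
    proof -
      have "0 \<le> sqrt (real d) - v" using that L2_set_nonneg[of x "{..<d}"] by linarith
      then have "v * v \<le> v * sqrt (real d)" using v by (intro mult_left_mono) auto
      have "(\<Sum>i<d. (x i)\<^sup>2) = (L2_set x {..<d})\<^sup>2" by (simp add: L2_set_def sum_nonneg)
      also have "\<dots> \<le> (sqrt (real d) - v)\<^sup>2" using that by (intro power_mono) auto
      also have "\<dots> \<le> real d - v * sqrt (real d)"
        using \<open>v * v \<le> v * sqrt (real d)\<close> by (simp add: power2_diff power2_eq_square algebra_simps)
      finally show ?thesis by (simp add: sum_subtractf)
    qed
    have "slice C0 d 1 1 0 l \<le> (\<integral>\<^sup>+x. ennreal (\<Prod>i<d. cube_weight 1 0 (x i))
        * indicator {x. v * sqrt (real d) \<le> (\<Sum>i<d. 1 - (x i)\<^sup>2)} x \<partial>leb_space d)"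
      unfolding slice_def
    proof (intro nn_integral_mono mult_left_mono)
      fix x :: "nat \<Rightarrow> real"
      show "indicator {x. sqrt 1 * L2_set x {..<d} \<le> sqrt (real d) + C0 * (1 - sqrt 1 * \<bar>l\<bar>)} x
        \<le> (indicator {x. v * sqrt (real d) \<le> (\<Sum>i<d. 1 - (x i)\<^sup>2)} x :: ennreal)"
        using sub[of x] by (auto simp: indicator_def v_def algebra_simps)
    qed simp
    also have "\<dots> \<le> ennreal (exp (9 / 8 - v)) * ennreal Z"
      unfolding Z_def cube_weight_nn_integral[of 1 0 d, simplified, symmetric]
    proof (rule product_chernoff[where m = "- 2"])
      show "integrable lborel (cube_weight 1 0)"
        using cube_weight_integrable[of 1 "\<lambda>_. 1" 0] by simp
      show "1 - y\<^sup>2 \<in> {- 2..- 2 + 3}" if "cube_weight 1 0 y \<noteq> 0" for y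
        using that by (auto simp: cube_weight_def split: split_indicator_asm)
    qed (use d in \<open>auto simp: cube_weight_nonneg cube_weight_integral_pos cube_weight_uniform_mean\<close>)
    also have "\<dots> = ennreal (exp (9 / 8 - v) * Z)"
      by (simp add: ennreal_mult')
    also have "\<dots> \<le> ennreal (exp (9 / 8 + C0 - \<bar>l\<bar>) * Z)"
      using Z v by (intro ennreal_leI mult_right_mono) auto
    finally show ?thesis by (simp add: Z_def)
  qed
qed

section \<open>Gibbs measures on rescaled bodies and their axial marginals\<close>

definition scaled_body :: "real \<Rightarrow> nat \<Rightarrow> real \<Rightarrow> real \<Rightarrow> ((nat \<Rightarrow> real) \<times> real) set" where
  "scaled_body C0 d a b = {p. fst p \<in> {..<d} \<rightarrow>\<^sub>E {y. a * y\<^sup>2 \<le> 3}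
     \<and> sqrt a * L2_set (fst p) {..<d} \<le> sqrt (real d) + C0 * (1 - sqrt b * \<bar>snd p\<bar>)}"

text \<open>
  One family covers both measures of interest: the uniform law is the case \<open>a = b = 1\<close>, \<open>t = 0\<close>, and the
  tilted law is the case where \<open>a\<close> and \<open>b\<close> are the variances of the uniform law.
\<close>

definition gibbs :: "real \<Rightarrow> nat \<Rightarrow> real \<Rightarrow> real \<Rightarrow> real \<Rightarrow> (nat \<Rightarrow> real) \<times> real \<Rightarrow> ennreal" where
  "gibbs C0 d a b t p = indicator (scaled_body C0 d a b) p
     * ennreal (exp (- t * ((L2_set (fst p) {..<d})\<^sup>2 + (snd p)\<^sup>2)))"

lemma leb_prod_eq: "leb_prod d = leb_space d \<Otimes>\<^sub>M lborel"
  by (simp add: leb_prod_def)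

lemma scaled_body_sets[measurable]: "scaled_body C0 d a b \<in> sets (leb_prod d)"
proof -
  have "scaled_body C0 d a b = {p \<in> space (leb_prod d). (\<forall>i\<in>{..<d}. a * (fst p i)\<^sup>2 \<le> 3)
     \<and> sqrt a * L2_set (fst p) {..<d} \<le> sqrt (real d) + C0 * (1 - sqrt b * \<bar>snd p\<bar>)}"
    by (auto simp: scaled_body_def leb_prod_eq space_pair_measure space_PiM PiE_iff extensional_def)
  also have "\<dots> \<in> sets (leb_prod d)"
    unfolding leb_prod_eq by measurable
  finally show ?thesis .
qed

lemma gibbs_measurable[measurable]: "gibbs C0 d a b t \<in> borel_measurable (leb_prod d)"
proof -
  have [measurable]: "(\<lambda>p. L2_set (fst p) {..<d}) \<in> borel_measurable (leb_prod d)"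
    "snd \<in> borel_measurable (leb_prod d)"
    unfolding leb_prod_eq by measurable
  show ?thesis unfolding gibbs_def by measurable
qed

text \<open>
  For fixed height both the Gaussian factor and the cube factorise over the coordinates; only the ball
  constraint couples them.
\<close>

lemma gibbs_marginal:
  "(\<integral>\<^sup>+x. gibbs C0 d a b t (x, l) \<partial>leb_space d) = ennreal (exp (- t * l\<^sup>2)) * slice C0 d a b t l"
proof -
  have "gibbs C0 d a b t (x, l) = ennreal (exp (- t * l\<^sup>2)) * (ennreal (\<Prod>i<d. cube_weight a t (x i))
     * indicator {x. sqrt a * L2_set x {..<d} \<le> sqrt (real d) + C0 * (1 - sqrt b * \<bar>l\<bar>)} x)"
    if "x \<in> space (leb_space d)" for x
  proof (cases "\<forall>i<d. a * (x i)\<^sup>2 \<le> 3")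
    case True
    then have "(\<Prod>i<d. cube_weight a t (x i)) = (\<Prod>i<d. exp (- t * (x i)\<^sup>2))"
      by (intro prod.cong) (auto simp: cube_weight_def)
    also have "\<dots> = exp (- t * (L2_set x {..<d})\<^sup>2)"
      by (simp add: L2_set_def sum_nonneg exp_sum[symmetric] sum_distrib_left sum_negf)
    finally have "(\<Prod>i<d. cube_weight a t (x i)) = exp (- t * (L2_set x {..<d})\<^sup>2)" .
    then show ?thesis
      using True that
      by (auto simp: gibbs_def scaled_body_def space_PiM PiE_iff ennreal_mult'[symmetric]
          exp_add[symmetric] algebra_simps split: split_indicator)
  next
    case False
    then obtain i where i: "i < d" "\<not> a * (x i)\<^sup>2 \<le> 3" by blast
    then have "(\<Prod>i<d. cube_weight a t (x i)) = 0" "(x, l) \<notin> scaled_body C0 d a b"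
      by (auto simp: cube_weight_def scaled_body_def PiE_iff intro!: bexI[of _ i])
    then show ?thesis by (simp only: gibbs_def) simp
  qed
  then have "(\<integral>\<^sup>+x. gibbs C0 d a b t (x, l) \<partial>leb_space d)
    = (\<integral>\<^sup>+x. ennreal (exp (- t * l\<^sup>2)) * (ennreal (\<Prod>i<d. cube_weight a t (x i))
     * indicator {x. sqrt a * L2_set x {..<d} \<le> sqrt (real d) + C0 * (1 - sqrt b * \<bar>l\<bar>)} x) \<partial>leb_space d)"
    by (rule nn_integral_cong)
  also have "\<dots> = ennreal (exp (- t * l\<^sup>2)) * slice C0 d a b t l"
    unfolding slice_def by (subst nn_integral_cmult) auto
  finally show ?thesis .
qed

lemma nn_integral_leb_prod:
  assumes "f \<in> borel_measurable (leb_prod d)"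
  shows "(\<integral>\<^sup>+p. f p \<partial>leb_prod d) = (\<integral>\<^sup>+l. (\<integral>\<^sup>+x. f (x, l) \<partial>leb_space d) \<partial>lborel)"
proof -
  interpret sigma_finite_measure "leb_space d" by (rule sigma_finite_leb_space)
  interpret pair_sigma_finite "leb_space d" "lborel :: real measure" ..
  show ?thesis
    using assms unfolding leb_prod_eq by (subst nn_integral_snd) auto
qed

definition gibbs_total :: "real \<Rightarrow> nat \<Rightarrow> real \<Rightarrow> real \<Rightarrow> real \<Rightarrow> ennreal" where
  "gibbs_total C0 d a b t = (\<integral>\<^sup>+p. gibbs C0 d a b t p \<partial>leb_prod d)"

definition gibbs_measure :: "real \<Rightarrow> nat \<Rightarrow> real \<Rightarrow> real \<Rightarrow> real \<Rightarrow> ((nat \<Rightarrow> real) \<times> real) measure" where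
  "gibbs_measure C0 d a b t = density (leb_prod d) (\<lambda>p. gibbs C0 d a b t p / gibbs_total C0 d a b t)"

definition axial_density :: "real \<Rightarrow> nat \<Rightarrow> real \<Rightarrow> real \<Rightarrow> real \<Rightarrow> real \<Rightarrow> real" where
  "axial_density C0 d a b t l
     = exp (- t * l\<^sup>2) * enn2real (slice C0 d a b t l) / enn2real (gibbs_total C0 d a b t)"

lemma gibbs_total_eq:
  "gibbs_total C0 d a b t = (\<integral>\<^sup>+l. ennreal (exp (- t * l\<^sup>2)) * slice C0 d a b t l \<partial>lborel)"
  unfolding gibbs_total_def by (subst nn_integral_leb_prod) (auto simp: gibbs_marginal)

lemma slice_finite: "0 < a \<Longrightarrow> slice C0 d a b t l < \<infinity>"
  using slice_le[of a C0 d b t l] by (auto simp: order_le_less_trans)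

lemma slice_support:
  assumes "0 < a" "0 < b" "0 < C0" "(sqrt (real d) / C0 + 1) / sqrt b < \<bar>l\<bar>"
  shows "slice C0 d a b t l = 0"
proof (rule slice_eq_0)
  have "sqrt (real d) / C0 + 1 < sqrt b * \<bar>l\<bar>" using assms by (simp add: field_simps)
  then have "C0 * (sqrt (real d) / C0 + 1) < C0 * (sqrt b * \<bar>l\<bar>)" using assms by (intro mult_strict_left_mono)
  then show "sqrt (real d) + C0 * (1 - sqrt b * \<bar>l\<bar>) < 0" using assms by (simp add: algebra_simps)
qed (use assms in simp)

lemma gibbs_total_finite:
  assumes "0 < a" "0 < b" "0 < C0" "0 \<le> t"
  shows "gibbs_total C0 d a b t < \<infinity>"
proof -
  define L where "L = (sqrt (real d) / C0 + 1) / sqrt b"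
  have "gibbs_total C0 d a b t \<le> (\<integral>\<^sup>+l. ennreal (cube_mass d a t) * indicator {-L..L} l \<partial>lborel)"
    unfolding gibbs_total_eq
  proof (rule nn_integral_mono)
    fix l
    have "ennreal (exp (- t * l\<^sup>2)) * slice C0 d a b t l \<le> 1 * slice C0 d a b t l"
      using assms by (intro mult_right_mono) auto
    also have "\<dots> \<le> ennreal (cube_mass d a t) * indicator {-L..L} l"
    proof (cases "\<bar>l\<bar> \<le> L")
      case True
      then show ?thesis using slice_le[OF assms(1)] by (auto simp: abs_le_iff)
    next
      case False
      then show ?thesis using slice_support[of a b C0 d l t] assms by (auto simp: L_def)
    qed
    finally show "ennreal (exp (- t * l\<^sup>2)) * slice C0 d a b t l \<le> ennreal (cube_mass d a t) * indicator {-L..L} l" .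
  qed
  also have "\<dots> < \<infinity>"
    by (auto simp: nn_integral_cmult_indicator ennreal_mult_less_top emeasure_lborel_Icc_eq)
  finally show ?thesis .
qed

lemma gibbs_total_pos:
  assumes "0 < r" "0 \<le> t" "\<And>l. \<bar>l\<bar> \<le> r \<Longrightarrow> ennreal z \<le> slice C0 d a b t l" "0 < z"
  shows "0 < gibbs_total C0 d a b t"
proof -
  have "0 < ennreal (exp (- t * r\<^sup>2) * z) * ennreal (r - - r)"
    using assms by (simp add: ennreal_zero_less_mult_iff)
  also have "\<dots> = (\<integral>\<^sup>+l. ennreal (exp (- t * r\<^sup>2) * z) * indicator {-r..r} l \<partial>lborel)"
    using assms by (subst nn_integral_cmult_indicator) auto
  also have "\<dots> \<le> gibbs_total C0 d a b t"
    unfolding gibbs_total_eq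
  proof (rule nn_integral_mono)
    fix l
    show "ennreal (exp (- t * r\<^sup>2) * z) * indicator {-r..r} l \<le> ennreal (exp (- t * l\<^sup>2)) * slice C0 d a b t l"
    proof (cases "\<bar>l\<bar> \<le> r")
      case True
      then have "l\<^sup>2 \<le> r\<^sup>2" using assms(1) abs_le_square_iff[of l r] by simp
      then have "exp (- t * r\<^sup>2) \<le> exp (- t * l\<^sup>2)" using assms by (auto intro: mult_left_mono)
      then have "ennreal (exp (- t * r\<^sup>2)) * ennreal z \<le> ennreal (exp (- t * l\<^sup>2)) * slice C0 d a b t l"
        using assms(3)[OF True] by (intro mult_mono ennreal_leI) auto
      then show ?thesis using True by (auto simp: ennreal_mult' indicator_def)
    next
      case False
      then show ?thesis by (auto simp: indicator_def)
    qed
  qed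
  finally show ?thesis .
qed

lemma prob_space_gibbs_measure:
  assumes "0 < gibbs_total C0 d a b t" "gibbs_total C0 d a b t < \<infinity>"
  shows "prob_space (gibbs_measure C0 d a b t)"
proof (rule prob_spaceI)
  have "emeasure (gibbs_measure C0 d a b t) (space (gibbs_measure C0 d a b t))
      = (\<integral>\<^sup>+p. gibbs C0 d a b t p / gibbs_total C0 d a b t \<partial>leb_prod d)"
    unfolding gibbs_measure_def by (subst emeasure_density) (auto intro!: nn_integral_cong)
  also have "\<dots> = gibbs_total C0 d a b t / gibbs_total C0 d a b t"
    by (subst nn_integral_divide) (auto simp: gibbs_total_def)
  also have "\<dots> = 1" using assms by (intro ennreal_divide_self) auto
  finally show "emeasure (gibbs_measure C0 d a b t) (space (gibbs_measure C0 d a b t)) = 1" .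
qed

lemma axial_density_measurable[measurable]: "axial_density C0 d a b t \<in> borel_measurable borel"
  unfolding axial_density_def by measurable

lemma axial_density_eq:
  assumes "0 < a" "0 < gibbs_total C0 d a b t" "gibbs_total C0 d a b t < \<infinity>"
  shows "ennreal (axial_density C0 d a b t l)
    = ennreal (exp (- t * l\<^sup>2)) * slice C0 d a b t l / gibbs_total C0 d a b t"
proof -
  obtain n where n: "gibbs_total C0 d a b t = ennreal n" "0 < n"
    using assms by (cases "gibbs_total C0 d a b t") auto
  obtain s where s: "slice C0 d a b t l = ennreal s" "0 \<le> s"
    using slice_finite[OF assms(1), of C0 d b t l] by (cases "slice C0 d a b t l") auto
  show ?thesis
    using n s by (simp add: axial_density_def ennreal_mult'[symmetric] divide_ennreal)
qed

text \<open>
  Integrating out \<open>x\<close> by Tonelli; it reduces the axial variance to one for a density on the line.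
\<close>

lemma distr_gibbs_measure_snd:
  assumes "0 < a" "0 < gibbs_total C0 d a b t" "gibbs_total C0 d a b t < \<infinity>"
  shows "distr (gibbs_measure C0 d a b t) lborel snd = density lborel (axial_density C0 d a b t)"
proof (rule measure_eqI)
  have [measurable]: "snd \<in> measurable (leb_prod d) lborel" unfolding leb_prod_eq by measurable
  fix A assume "A \<in> sets (distr (gibbs_measure C0 d a b t) lborel snd)"
  then have A[measurable]: "A \<in> sets borel" by simp
  have snd'[measurable]: "snd \<in> borel_measurable (leb_prod d)" unfolding leb_prod_eq by measurable
  have "emeasure (distr (gibbs_measure C0 d a b t) lborel snd) A
     = (\<integral>\<^sup>+p. gibbs C0 d a b t p / gibbs_total C0 d a b t * indicator (snd -` A \<inter> space (leb_prod d)) p \<partial>leb_prod d)"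
    using A snd' by (subst emeasure_distr) (auto simp: gibbs_measure_def emeasure_density)
  also have "\<dots> = (\<integral>\<^sup>+p. gibbs C0 d a b t p / gibbs_total C0 d a b t * indicator A (snd p) \<partial>leb_prod d)"
    by (intro nn_integral_cong) (auto split: split_indicator)
  also have "\<dots> = (\<integral>\<^sup>+l. (\<integral>\<^sup>+x. gibbs C0 d a b t (x, l) / gibbs_total C0 d a b t * indicator A l \<partial>leb_space d) \<partial>lborel)"
    by (subst nn_integral_leb_prod) auto
  also have "\<dots> = (\<integral>\<^sup>+l. ennreal (axial_density C0 d a b t l) * indicator A l \<partial>lborel)"
  proof (rule nn_integral_cong)
    fix l
    have [measurable]: "(\<lambda>x. gibbs C0 d a b t (x, l)) \<in> borel_measurable (leb_space d)"
      using gibbs_measurable[of C0 d a b t] unfolding leb_prod_eq by measurable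
    show "(\<integral>\<^sup>+x. gibbs C0 d a b t (x, l) / gibbs_total C0 d a b t * indicator A l \<partial>leb_space d)
      = ennreal (axial_density C0 d a b t l) * indicator A l"
      unfolding axial_density_eq[OF assms] gibbs_marginal[symmetric]
      by (simp add: nn_integral_multc nn_integral_divide)
  qed
  also have "\<dots> = emeasure (density lborel (axial_density C0 d a b t)) A"
    by (subst emeasure_density) auto
  finally show "emeasure (distr (gibbs_measure C0 d a b t) lborel snd) A
      = emeasure (density lborel (axial_density C0 d a b t)) A" .
qed simp

section \<open>Variances\<close>

lemma (in prob_space) bounded_variance:
  fixes X :: "'a \<Rightarrow> real"
  assumes [measurable]: "X \<in> borel_measurable M" and B: "AE x in M. \<bar>X x\<bar> \<le> B"
  shows bounded_variance_le: "variance X \<le> expectation (\<lambda>x. (X x)\<^sup>2)"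
    and bounded_variance_pos: "(\<And>c. AE x in M. X x \<noteq> c) \<Longrightarrow> 0 < variance X"
proof -
  have X: "integrable M X" using B by (intro integrable_const_bound[where B = B]) auto
  have sq: "AE x in M. norm ((X x)\<^sup>2) \<le> B\<^sup>2"
    using B by eventually_elim (use power_mono[of "\<bar>X _\<bar>" B 2] in auto)
  then have X2: "integrable M (\<lambda>x. (X x)\<^sup>2)" by (intro integrable_const_bound[where B = "B\<^sup>2"]) auto
  show "variance X \<le> expectation (\<lambda>x. (X x)\<^sup>2)"
    using variance_eq[OF X X2] by simp
  show "0 < variance X" if ne: "\<And>c. AE x in M. X x \<noteq> c"
  proof (rule ccontr)
    assume "\<not> 0 < variance X"
    then have "variance X = 0" using variance_positive[of X] by simp
    moreover have "integrable M (\<lambda>x. (X x - expectation X)\<^sup>2)"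
      using X X2 by (simp add: power2_diff)
    ultimately have "AE x in M. (X x - expectation X)\<^sup>2 = 0"
      by (subst (asm) integral_nonneg_eq_0_iff_AE) auto
    then have "AE x in M. False"
      using ne[of "expectation X"] by eventually_elim simp
    then show False by simp
  qed
qed

text \<open>
  By symmetry the mean vanishes. Since \<open>l\<^sup>2 - R\<^sup>2 / 18\<close> is nonnegative off \<open>[-R, R]\<close>, its integral against \<open>g\<close>
  is at least its integral over \<open>[-R, R]\<close>. There \<open>g \<ge> z / 6\<close> bounds the part with \<open>l\<^sup>2\<close> from below and \<open>g \<le> z\<close>
  bounds the part with \<open>R\<^sup>2 / 18\<close> from above, and the constant \<open>18\<close> is the one for which the two bounds
  cancel: \<open>z / 6 \<cdot> 2 R\<^sup>3 / 3 = z R\<^sup>2 / 18 \<cdot> 2 R\<close>.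
\<close>

lemma plateau_variance:
  fixes g :: "real \<Rightarrow> real"
  defines "M \<equiv> density lborel g"
  assumes [measurable]: "g \<in> borel_measurable borel" and g0: "\<And>l. 0 \<le> g l"
    and supp: "\<And>l. L < \<bar>l\<bar> \<Longrightarrow> g l = 0" and even: "\<And>l. g (- l) = g l"
    and prob: "prob_space M" and R: "0 \<le> R"
    and plateau: "\<And>l. \<bar>l\<bar> \<le> R \<Longrightarrow> z / 6 \<le> g l" "\<And>l. \<bar>l\<bar> \<le> R \<Longrightarrow> g l \<le> z"
  shows "R\<^sup>2 / 18 \<le> (\<integral>l. (l - (\<integral>l. l \<partial>M))\<^sup>2 \<partial>M)"
proof -
  interpret prob_space M by fact
  have [simp]: "sets M = sets borel" by (simp add: M_def)
  have id[measurable]: "(\<lambda>l. l) \<in> borel_measurable M" by (simp add: M_def)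
  have "AE l in M. \<bar>l\<bar> \<le> L"
    unfolding M_def using supp by (subst AE_density) (force intro!: AE_I2 simp: not_le[symmetric])+
  then have "AE l in M. norm (l\<^sup>2) \<le> L\<^sup>2"
    by eventually_elim (use power_mono[of "\<bar>_\<bar>" L 2] in auto)
  then have "integrable M (\<lambda>l. l\<^sup>2)"
    by (intro integrable_const_bound[where B = "L\<^sup>2"]) (auto simp: M_def)
  then have int2: "integrable lborel (\<lambda>l. g l * l\<^sup>2)"
    unfolding M_def using g0 by (subst (asm) integrable_density) auto
  have int1: "integrable lborel g" "(\<integral>l. g l \<partial>lborel) = 1"
    using integrable_density[of "\<lambda>_. 1::real" lborel g] integral_density[of "\<lambda>_. 1::real" lborel g]
      g0 prob_space integrable_const[of "1::real"] by (auto simp: M_def)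
  have "(\<integral>l. l \<partial>M) = (\<integral>l. g l * l \<partial>lborel)"
    unfolding M_def using g0 by (subst integral_density) auto
  also have "\<dots> = - (\<integral>l. g l * l \<partial>lborel)"
    using lborel_integral_real_affine[of "-1" "\<lambda>l. g l * l" 0] by (simp add: even)
  finally have mean: "(\<integral>l. l \<partial>M) = 0"
    using \<open>(\<integral>l. l \<partial>M) = (\<integral>l. g l * l \<partial>lborel)\<close> by simp
  have "(\<integral>l. (z / 6 * l\<^sup>2 - z * R\<^sup>2 / 18) * indicator {-R..R} l \<partial>lborel)
      = (z / 18 * R ^ 3 - z * R\<^sup>2 / 18 * R) - (z / 18 * (- R) ^ 3 - z * R\<^sup>2 / 18 * (- R))"
    and intp: "integrable lborel (\<lambda>l. (z / 6 * l\<^sup>2 - z * R\<^sup>2 / 18) * indicator {-R..R} l)"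
  proof -
    have "has_bochner_integral lborel (\<lambda>l. (z / 6 * l\<^sup>2 - z * R\<^sup>2 / 18) * indicator {-R..R} l)
      ((z / 18 * R ^ 3 - z * R\<^sup>2 / 18 * R) - (z / 18 * (- R) ^ 3 - z * R\<^sup>2 / 18 * (- R)))"
    proof (rule has_bochner_integral_FTC_Icc_real)
      show "((\<lambda>l. z / 18 * l ^ 3 - z * R\<^sup>2 / 18 * l) has_real_derivative z / 6 * l\<^sup>2 - z * R\<^sup>2 / 18) (at l)" for l
        by (auto intro!: derivative_eq_intros)
    qed (use R in auto)
    then show "(\<integral>l. (z / 6 * l\<^sup>2 - z * R\<^sup>2 / 18) * indicator {-R..R} l \<partial>lborel)
      = (z / 18 * R ^ 3 - z * R\<^sup>2 / 18 * R) - (z / 18 * (- R) ^ 3 - z * R\<^sup>2 / 18 * (- R))"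
      "integrable lborel (\<lambda>l. (z / 6 * l\<^sup>2 - z * R\<^sup>2 / 18) * indicator {-R..R} l)"
      by (auto simp: has_bochner_integral_iff)
  qed
  then have "0 = (\<integral>l. (z / 6 * l\<^sup>2 - z * R\<^sup>2 / 18) * indicator {-R..R} l \<partial>lborel)"
    by (simp add: power2_eq_square power3_eq_cube)
  also have "\<dots> \<le> (\<integral>l. g l * l\<^sup>2 - R\<^sup>2 / 18 * g l \<partial>lborel)"
  proof (rule integral_mono)
    fix l
    show "(z / 6 * l\<^sup>2 - z * R\<^sup>2 / 18) * indicator {-R..R} l \<le> g l * l\<^sup>2 - R\<^sup>2 / 18 * g l"
    proof (cases "\<bar>l\<bar> \<le> R")
      case True
      have "z / 6 * l\<^sup>2 \<le> g l * l\<^sup>2" using plateau(1)[OF True] by (intro mult_right_mono) auto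
      moreover have "R\<^sup>2 / 18 * g l \<le> R\<^sup>2 / 18 * z" using plateau(2)[OF True] by (intro mult_left_mono) auto
      ultimately show ?thesis using True by (simp add: abs_le_iff mult.commute)
    next
      case False
      then have "R\<^sup>2 \<le> l\<^sup>2" using R abs_le_square_iff[of R l] by simp
      moreover have "0 \<le> l\<^sup>2" by simp
      ultimately have "R\<^sup>2 / 18 \<le> l\<^sup>2" by linarith
      then have "R\<^sup>2 / 18 * g l \<le> l\<^sup>2 * g l" using g0 by (intro mult_right_mono) auto
      moreover have "l \<notin> {-R..R}" using False by (auto simp: abs_le_iff)
      ultimately show ?thesis by (simp add: mult.commute)
    qed
  qed (use intp int1 int2 in auto)
  also have "\<dots> = (\<integral>l. g l * l\<^sup>2 \<partial>lborel) - R\<^sup>2 / 18"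
    using int1 int2 by simp
  also have "(\<integral>l. g l * l\<^sup>2 \<partial>lborel) = (\<integral>l. l\<^sup>2 \<partial>M)"
    unfolding M_def using g0 by (subst integral_density) auto
  finally show ?thesis by (simp add: mean)
qed

lemma null_coordinate:
  assumes "i < d"
  shows "AE p in leb_prod d. fst p i \<noteq> c"
proof -
  interpret product_sigma_finite "\<lambda>_::nat. lborel :: real measure" ..
  define A where "A = PiE {..<d} (\<lambda>j. if j = i then {c} else UNIV)"
  have A: "A \<in> sets (leb_space d)" unfolding A_def by (intro sets_PiM_I_finite) auto
  have "emeasure (leb_space d) A = (\<Prod>j<d. emeasure lborel (if j = i then {c} else UNIV))"
    unfolding A_def by (rule emeasure_PiM) auto
  also have "\<dots> = 0" using assms by (intro prod_zero) auto
  finally have "emeasure (leb_prod d) (A \<times> UNIV) = 0"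
    using A unfolding leb_prod_eq by (subst lborel.emeasure_pair_measure_Times) auto
  moreover have "A \<times> UNIV \<in> sets (leb_prod d)" unfolding leb_prod_eq using A by auto
  ultimately have "A \<times> UNIV \<in> null_sets (leb_prod d)" by auto
  then show ?thesis
  proof (rule AE_I')
    show "{p \<in> space (leb_prod d). \<not> fst p i \<noteq> c} \<subseteq> A \<times> UNIV"
      by (rule subsetI) (simp add: leb_prod_eq space_pair_measure space_PiM A_def PiE_iff mem_Times_iff)
  qed
qed

section \<open>The isotropic rescaling\<close>

lemma body0_eq: "body0 C0 d = scaled_body C0 d 1 1"
proof -
  have edge: "{y::real. 1 * y\<^sup>2 \<le> 3} = {- sqrt 3..sqrt 3}"
    using edge_interval[of 1] by simp
  show ?thesis unfolding body0_def scaled_body_def edge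
    by (intro set_eqI) (simp add: case_prod_beta mem_Times_iff)
qed

lemma unif0_eq: "unif0 C0 d = gibbs_measure C0 d 1 1 0"
proof -
  have "gibbs C0 d 1 1 0 = indicator (body0 C0 d)"
    by (auto simp: gibbs_def body0_eq fun_eq_iff)
  then show ?thesis
    using scaled_body_sets[of C0 d 1 1]
    by (simp add: unif0_def uniform_measure_def gibbs_measure_def gibbs_total_def body0_eq)
qed

text \<open>
  Positivity of the two variances makes the rescaling a bijection; otherwise division by zero would
  collapse the body.
\<close>

lemma body_eq:
  assumes a: "0 < var_x C0 d" and b: "0 < var_l C0 d"
  shows "body C0 d = scaled_body C0 d (var_x C0 d) (var_l C0 d)"
proof -
  define a b where "a = sqrt (var_x C0 d)" and "b = sqrt (var_l C0 d)"
  have ab: "0 < a" "0 < b" "var_x C0 d = a\<^sup>2" "var_l C0 d = b\<^sup>2"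
    using assms by (auto simp: a_def b_def)
  have norm: "a * L2_set x {..<d} = L2_set (\<lambda>i. a * x i) {..<d}" for x
    using ab by (simp add: L2_set_right_distrib)
  have "body C0 d = (\<lambda>(x, l). ((\<lambda>i\<in>{..<d}. x i / a), l / b)) ` scaled_body C0 d 1 1"
    by (simp add: body_def body0_eq a_def b_def)
  also have "\<dots> = scaled_body C0 d (a\<^sup>2) (b\<^sup>2)"
  proof (intro equalityI subsetI)
    fix p assume "p \<in> (\<lambda>(x, l). ((\<lambda>i\<in>{..<d}. x i / a), l / b)) ` scaled_body C0 d 1 1"
    then obtain x l where p: "p = ((\<lambda>i\<in>{..<d}. x i / a), l / b)" and xl: "(x, l) \<in> scaled_body C0 d 1 1"
      by auto
    have "L2_set (\<lambda>i. a * fst p i) {..<d} = L2_set x {..<d}"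
      using ab by (intro L2_set_cong) (auto simp: p)
    then show "p \<in> scaled_body C0 d (a\<^sup>2) (b\<^sup>2)"
      using xl ab norm[of "fst p"] by (auto simp: scaled_body_def p PiE_iff power_divide abs_divide)
  next
    fix p assume p: "p \<in> scaled_body C0 d (a\<^sup>2) (b\<^sup>2)"
    define x where "x = (\<lambda>i\<in>{..<d}. a * fst p i)"
    have "L2_set x {..<d} = L2_set (\<lambda>i. a * fst p i) {..<d}"
      by (intro L2_set_cong) (auto simp: x_def)
    then have "(x, b * snd p) \<in> scaled_body C0 d 1 1"
      using p ab norm[of "fst p"]
      by (auto simp: scaled_body_def x_def PiE_iff power_mult_distrib abs_mult)
    moreover have "p = ((\<lambda>i\<in>{..<d}. x i / a), (b * snd p) / b)"
      using p ab by (auto simp: scaled_body_def x_def prod_eq_iff fun_eq_iff PiE_iff extensional_def)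
    ultimately show "p \<in> (\<lambda>(x, l). ((\<lambda>i\<in>{..<d}. x i / a), l / b)) ` scaled_body C0 d 1 1"
      by (intro rev_image_eqI) auto
  qed
  finally show ?thesis by (simp add: ab)
qed

lemma mu_eq:
  assumes "0 < var_x C0 d" "0 < var_l C0 d"
  shows "mu C0 d t = gibbs_measure C0 d (var_x C0 d) (var_l C0 d) t"
proof -
  have "gauss_weight C0 d t = gibbs C0 d (var_x C0 d) (var_l C0 d) t"
    by (auto simp: gauss_weight_def gibbs_def body_eq[OF assms] fun_eq_iff)
  then show ?thesis by (simp add: mu_def gibbs_measure_def gibbs_total_def)
qed

lemma expectation_snd_gibbs_measure:
  fixes f :: "real \<Rightarrow> real"
  assumes "0 < a" "0 < gibbs_total C0 d a b t" "gibbs_total C0 d a b t < \<infinity>"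
    and [measurable]: "f \<in> borel_measurable borel"
  shows "(\<integral>p. f (snd p) \<partial>gibbs_measure C0 d a b t) = (\<integral>l. f l \<partial>density lborel (axial_density C0 d a b t))"
proof -
  have "snd \<in> measurable (leb_prod d) lborel" unfolding leb_prod_eq by measurable
  then show ?thesis
    unfolding distr_gibbs_measure_snd[OF assms(1-3), symmetric]
    by (subst integral_distr) (auto simp: gibbs_measure_def)
qed

lemma variance_snd_gibbs_measure:
  assumes "0 < a" "0 < gibbs_total C0 d a b t" "gibbs_total C0 d a b t < \<infinity>"
  shows "prob_space.variance (gibbs_measure C0 d a b t) (\<lambda>(x, l). l)
    = prob_space.variance (density lborel (axial_density C0 d a b t)) (\<lambda>l. l)"
proof -
  have *: "(\<lambda>(x, l). l) = (snd :: (nat \<Rightarrow> real) \<times> real \<Rightarrow> real)" by auto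
  show ?thesis
    unfolding * using expectation_snd_gibbs_measure[OF assms, of "\<lambda>l. l"]
    expectation_snd_gibbs_measure[OF assms, of "\<lambda>l. (l - (\<integral>l. l \<partial>density lborel (axial_density C0 d a b t)))\<^sup>2"]
    by simp
qed

lemma AE_gibbs_measure:
  assumes "AE p in leb_prod d. p \<in> scaled_body C0 d a b \<longrightarrow> P p"
  shows "AE p in gibbs_measure C0 d a b t. P p"
proof -
  have "AE p in leb_prod d. 0 < gibbs C0 d a b t p / gibbs_total C0 d a b t \<longrightarrow> P p"
    using assms by eventually_elim (auto simp: gibbs_def indicator_def split: if_splits)
  then show ?thesis unfolding gibbs_measure_def by (subst AE_density) simp_all
qed

text \<open>
  The constant \<open>6\<close> enters here: for \<open>|l| \<le> 1 / 2\<close> the radius exceeds \<open>sqrt d\<close> by at least \<open>C0 / 2 \<ge> 3\<close>.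
\<close>

lemma uniform_slice_ge:
  assumes d: "1 \<le> d" and C0: "6 \<le> C0" and l: "\<bar>l\<bar> \<le> 1 / 2"
  shows "ennreal (cube_mass d 1 0 / 2) \<le> slice C0 d 1 1 0 l"
proof (rule slice_ge_half[OF zero_less_one d _ refl, where q = 0])
  show "(\<integral>y. cube_weight 1 0 y * (1 * y\<^sup>2 - (1 - 0)) \<partial>lborel) \<le> 0"
    using tilted_second_moment[of 1 0 0 0] by simp
  have "6 * (1 / 2) \<le> C0 * (1 - \<bar>l\<bar>)" using C0 l by (intro mult_mono) auto
  then have 1: "sqrt (real d) + 3 \<le> sqrt (real d) + C0 * (1 - sqrt 1 * \<bar>l\<bar>)" by simp
  then show "0 \<le> sqrt (real d) + C0 * (1 - sqrt 1 * \<bar>l\<bar>)"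
    using real_sqrt_ge_zero[of "real d"] by linarith
  have "real d * (1 - 0) + 3 * sqrt (real d) \<le> (sqrt (real d) + 3)\<^sup>2"
    by (simp add: power2_sum)
  also have "\<dots> \<le> (sqrt (real d) + C0 * (1 - sqrt 1 * \<bar>l\<bar>))\<^sup>2"
    using 1 by (intro power_mono) auto
  finally show "real d * (1 - 0) + 3 * sqrt (real d) \<le> (sqrt (real d) + C0 * (1 - sqrt 1 * \<bar>l\<bar>))\<^sup>2" .
qed

lemma uniform_total:
  assumes d: "1 \<le> d" and C0: "6 \<le> C0"
  shows "ennreal (cube_mass d 1 0 / 2) \<le> gibbs_total C0 d 1 1 0" "gibbs_total C0 d 1 1 0 < \<infinity>"
proof -
  have "ennreal (cube_mass d 1 0 / 2) = (\<integral>\<^sup>+l. ennreal (cube_mass d 1 0 / 2) * indicator {-1/2..1/2::real} l \<partial>lborel)"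
    by (subst nn_integral_cmult_indicator) auto
  also have "\<dots> \<le> gibbs_total C0 d 1 1 0"
    unfolding gibbs_total_eq using uniform_slice_ge[OF d C0]
    by (intro nn_integral_mono) (auto simp: indicator_def abs_le_iff)
  finally show "ennreal (cube_mass d 1 0 / 2) \<le> gibbs_total C0 d 1 1 0" .
  show "gibbs_total C0 d 1 1 0 < \<infinity>" using C0 by (intro gibbs_total_finite) auto
qed

lemma uniform_total_pos:
  assumes d: "1 \<le> d" and C0: "6 \<le> C0"
  shows "0 < gibbs_total C0 d 1 1 0"
proof -
  have "0 < ennreal (cube_mass d 1 0 / 2)" using cube_mass_pos[of 1 d 0] by simp
  also have "\<dots> \<le> gibbs_total C0 d 1 1 0" by (rule uniform_total[OF assms])
  finally show ?thesis .
qed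

lemma var_x_bounds:
  assumes d: "1 \<le> d" and C0: "6 \<le> C0"
  shows "0 < var_x C0 d" "var_x C0 d \<le> 3"
proof -
  interpret prob_space "gibbs_measure C0 d 1 1 0"
    using uniform_total[OF assms] uniform_total_pos[OF assms] by (intro prob_space_gibbs_measure)
  let ?X = "\<lambda>(x, l). x 0 :: real"
  have X: "?X \<in> borel_measurable (gibbs_measure C0 d 1 1 0)"
    using d by (simp add: gibbs_measure_def leb_prod_eq)
  have sq: "AE p in gibbs_measure C0 d 1 1 0. (?X p)\<^sup>2 \<le> 3"
    using d by (intro AE_gibbs_measure AE_I2) (auto simp: scaled_body_def PiE_iff)
  then have bd: "AE p in gibbs_measure C0 d 1 1 0. \<bar>?X p\<bar> \<le> sqrt 3"
    by eventually_elim (use real_le_rsqrt in \<open>auto simp: real_le_rsqrt\<close>)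
  have ne: "AE p in gibbs_measure C0 d 1 1 0. ?X p \<noteq> c" for c
  proof (rule AE_gibbs_measure)
    have "AE p in leb_prod d. fst p 0 \<noteq> c" using d by (intro null_coordinate) simp
    then show "AE p in leb_prod d. p \<in> scaled_body C0 d 1 1 \<longrightarrow> ?X p \<noteq> c"
      by eventually_elim (simp add: case_prod_beta)
  qed
  show "0 < var_x C0 d"
    unfolding var_x_def unif0_eq by (rule bounded_variance_pos[OF X bd ne])
  have "integrable (gibbs_measure C0 d 1 1 0) (\<lambda>p. (?X p)\<^sup>2)"
    using X sq by (intro integrable_const_bound[where B = 3]) auto
  then have "expectation (\<lambda>p. (?X p)\<^sup>2) \<le> 3"
    using sq by (intro integral_le_const)
  then show "var_x C0 d \<le> 3"
    unfolding var_x_def unif0_eq using bounded_variance_le[OF X bd] by linarith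
qed

lemma second_moment_exp_abs: "(\<integral>\<^sup>+l. ennreal (l\<^sup>2 * exp (- \<bar>l\<bar>)) \<partial>lborel) \<le> ennreal 4"
proof -
  define f where "f l = ennreal (l\<^sup>2 * exp (- l)) * indicator {0..} l" for l :: real
  have [measurable]: "f \<in> borel_measurable borel" unfolding f_def by measurable
  have half: "(\<integral>\<^sup>+l. f l \<partial>lborel) = ennreal 2"
    unfolding f_def using nn_intergal_power_times_exp_Ici[of 2] by simp
  have "(\<integral>\<^sup>+l. ennreal (l\<^sup>2 * exp (- \<bar>l\<bar>)) \<partial>lborel) \<le> (\<integral>\<^sup>+l. f l + f (- l) \<partial>lborel)"
    by (intro nn_integral_mono) (auto simp: f_def indicator_def)
  also have "\<dots> = (\<integral>\<^sup>+l. f l \<partial>lborel) + (\<integral>\<^sup>+l. f (- l) \<partial>lborel)"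
    by (rule nn_integral_add) auto
  also have "(\<integral>\<^sup>+l. f (- l) \<partial>lborel) = (\<integral>\<^sup>+l. f l \<partial>lborel)"
    using nn_integral_real_affine[of f "-1" 0] by simp
  finally show ?thesis by (simp add: half flip: ennreal_plus)
qed

lemma axial_density_nonneg: "0 \<le> axial_density C0 d a b t l"
  by (simp add: axial_density_def)

lemma axial_density_support:
  assumes "0 < a" "0 < b" "0 < C0" "(sqrt (real d) / C0 + 1) / sqrt b < \<bar>l\<bar>"
  shows "axial_density C0 d a b t l = 0"
  using slice_support[OF assms] by (simp add: axial_density_def)

lemma prob_space_axial_density:
  assumes "0 < a" "0 < gibbs_total C0 d a b t" "gibbs_total C0 d a b t < \<infinity>"
  shows "prob_space (density lborel (axial_density C0 d a b t))"
proof -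
  interpret prob_space "gibbs_measure C0 d a b t" using assms(2,3) by (rule prob_space_gibbs_measure)
  have "snd \<in> measurable (leb_prod d) lborel" unfolding leb_prod_eq by measurable
  then show ?thesis
    unfolding distr_gibbs_measure_snd[OF assms, symmetric]
    by (intro prob_space_distr) (simp add: gibbs_measure_def)
qed

text \<open>
  The decay of the slices carries over to the density because the normalising constant is at least half
  of the mass of the cube, by the slices with \<open>|l| \<le> 1 / 2\<close>.
\<close>

lemma uniform_axial_density_le:
  assumes d: "1 \<le> d" and C0: "6 \<le> C0"
  shows "axial_density C0 d 1 1 0 l \<le> 2 * exp (9 / 8 + C0) * exp (- \<bar>l\<bar>)"
proof -
  define Z where "Z = cube_mass d 1 0"
  have Z: "0 < Z" unfolding Z_def by (rule cube_mass_pos) simp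
  define n where "n = enn2real (gibbs_total C0 d 1 1 0)"
  have "enn2real (ennreal (Z / 2)) \<le> n"
    unfolding n_def Z_def using uniform_total[OF assms] by (intro enn2real_mono) auto
  then have n: "Z / 2 \<le> n" using Z by simp
  define E where "E = exp (9 / 8 + C0) * exp (- \<bar>l\<bar>)"
  have "enn2real (slice C0 d 1 1 0 l) \<le> E * Z"
    unfolding Z_def E_def using uniform_slice_le[OF d, of C0 l] C0 cube_mass_pos[of 1 d 0]
    by (intro enn2real_leI) (auto simp flip: exp_add)
  also have "\<dots> \<le> E * (2 * n)" using n by (intro mult_left_mono) (auto simp: E_def)
  finally have "enn2real (slice C0 d 1 1 0 l) / n \<le> E * (2 * n) / n"
    using n Z by (intro divide_right_mono) auto
  also have "\<dots> = 2 * E" using n Z by simp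
  finally show ?thesis by (simp add: axial_density_def n_def E_def)
qed

lemma var_l_bounds:
  assumes d: "1 \<le> d" and C0: "6 \<le> C0"
  shows "0 < var_l C0 d" "var_l C0 d \<le> 8 * exp (9 / 8 + C0)"
proof -
  note tot = uniform_total_pos[OF assms] uniform_total(2)[OF assms]
  let ?g = "axial_density C0 d 1 1 0"
  have eq: "var_l C0 d = prob_space.variance (density lborel ?g) (\<lambda>l. l)"
    unfolding var_l_def unif0_eq by (rule variance_snd_gibbs_measure[OF _ tot]) simp
  interpret prob_space "density lborel ?g"
    by (rule prob_space_axial_density[OF _ tot]) simp
  define L where "L = sqrt (real d) / C0 + 1"
  have "?g l = 0" if "L < \<bar>l\<bar>" for l
    using that C0 by (intro axial_density_support) (auto simp: L_def)
  then have L: "AE l in density lborel ?g. \<bar>l\<bar> \<le> L"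
    by (subst AE_density) (force intro!: AE_I2 simp: not_le[symmetric])+
  have X: "(\<lambda>l. l) \<in> borel_measurable (density lborel ?g)" by simp
  have ne: "AE l in density lborel ?g. l \<noteq> c" for c
    using AE_lborel_singleton[of c] by (subst AE_density) (auto elim: eventually_mono)
  show "0 < var_l C0 d" unfolding eq by (rule bounded_variance_pos[OF X L ne])
  have "expectation (\<lambda>l. l\<^sup>2) = (\<integral>l. ?g l * l\<^sup>2 \<partial>lborel)"
    by (subst integral_density) (auto simp: axial_density_nonneg)
  also have "\<dots> = enn2real (\<integral>\<^sup>+l. ennreal (?g l * l\<^sup>2) \<partial>lborel)"
    by (intro integral_eq_nn_integral) (auto simp: axial_density_nonneg)
  also have "\<dots> \<le> 8 * exp (9 / 8 + C0)"
  proof (rule enn2real_leI)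
    have "(\<integral>\<^sup>+l. ennreal (?g l * l\<^sup>2) \<partial>lborel)
       \<le> (\<integral>\<^sup>+l. ennreal (2 * exp (9 / 8 + C0)) * ennreal (l\<^sup>2 * exp (- \<bar>l\<bar>)) \<partial>lborel)"
    proof (rule nn_integral_mono)
      fix l
      have "?g l * l\<^sup>2 \<le> 2 * exp (9 / 8 + C0) * exp (- \<bar>l\<bar>) * l\<^sup>2"
        using uniform_axial_density_le[OF assms] by (intro mult_right_mono) auto
      then show "ennreal (?g l * l\<^sup>2) \<le> ennreal (2 * exp (9 / 8 + C0)) * ennreal (l\<^sup>2 * exp (- \<bar>l\<bar>))"
        by (simp add: ennreal_mult'[symmetric] mult_ac ennreal_leI)
    qed
    also have "\<dots> \<le> ennreal (2 * exp (9 / 8 + C0)) * ennreal 4"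
      using mult_left_mono[OF second_moment_exp_abs, of "ennreal (2 * exp (9 / 8 + C0))"]
      by (subst nn_integral_cmult) auto
    also have "\<dots> = ennreal (8 * exp (9 / 8 + C0))"
      by (subst ennreal_mult'[symmetric]) auto
    finally show "(\<integral>\<^sup>+l. ennreal (?g l * l\<^sup>2) \<partial>lborel) \<le> ennreal (8 * exp (9 / 8 + C0))" .
  qed simp
  finally show "var_l C0 d \<le> 8 * exp (9 / 8 + C0)"
    unfolding eq using bounded_variance_le[OF X L] by linarith
qed

section \<open>The plateau of the axial density\<close>

text \<open>
  With \<open>x = \<eta> t\<close> the radius is at least \<open>sqrt d (1 - x) + 6\<close>, whose square exceeds \<open>d (1 - 2 x) + 3 sqrt d\<close>. The
  tilt lowers the mean of \<open>(\<Sum>i<d. a x\<^sub>i\<^sup>2)\<close> to at most \<open>d (1 - q)\<close>, and \<open>2 x \<le> q\<close> says that the shrinking of the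
  ball is dominated by this drop. The factor \<open>exp (- T)\<close> makes the drop uniform for \<open>t \<le> T\<close>.
\<close>

lemma tilted_slice_ge:
  assumes d: "1 \<le> d" and C0: "6 \<le> C0" and a: "0 < a" "a \<le> 3" and t: "0 < t" "t \<le> T"
    and \<eta>: "0 \<le> \<eta>" "\<eta> * T \<le> 1 / 2" "2 * \<eta> \<le> 4 / 15 * exp (- T)"
    and l: "C0 * (sqrt b * \<bar>l\<bar>) \<le> \<eta> * t * sqrt (real d)"
  shows "ennreal (cube_mass d a t / 2) \<le> slice C0 d a b t l"
proof (rule slice_ge_half[OF a(1) d _ refl])
  show "(\<integral>y. cube_weight a t y * (a * y\<^sup>2 - (1 - 4 / 15 * exp (- T) * t)) \<partial>lborel) \<le> 0"
    using a t by (intro tilted_second_moment) auto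
  let ?\<rho> = "sqrt (real d) + C0 * (1 - sqrt b * \<bar>l\<bar>)"
  define s where "s = sqrt (real d)"
  have s: "0 \<le> s" "s\<^sup>2 = real d" by (auto simp: s_def)
  define x where "x = \<eta> * t"
  have "x \<le> \<eta> * T" using \<eta> t unfolding x_def by (intro mult_left_mono) auto
  then have x: "0 \<le> x" "x \<le> 1 / 2" using \<eta> t by (auto simp: x_def)
  have sx: "s / 2 \<le> s * (1 - x)" using s x mult_left_mono[of "1 / 2" "1 - x" s] by simp
  have \<rho>: "s * (1 - x) + 6 \<le> ?\<rho>" using l C0 by (simp add: s_def x_def algebra_simps)
  then show "0 \<le> ?\<rho>" using sx s by linarith
  have "real d * (1 - 4 / 15 * exp (- T) * t) \<le> real d * (1 - 2 * x)"
    using mult_right_mono[OF \<eta>(3), of t] t by (intro mult_left_mono) (auto simp: x_def)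
  then have "real d * (1 - 4 / 15 * exp (- T) * t) + 3 * s \<le> s\<^sup>2 * (1 - 2 * x) + 3 * s"
    using s by simp
  also have "\<dots> \<le> (s * (1 - x))\<^sup>2 + 12 * (s * (1 - x)) + 36"
  proof -
    have "s\<^sup>2 * (1 - 2 * x) \<le> s\<^sup>2 * (1 - x)\<^sup>2"
      by (intro mult_left_mono) (auto simp: power2_diff)
    then show ?thesis using sx s by (simp add: power_mult_distrib)
  qed
  also have "\<dots> = (s * (1 - x) + 6)\<^sup>2" by (simp add: power2_sum)
  also have "\<dots> \<le> ?\<rho>\<^sup>2" using \<rho> sx s by (intro power_mono) auto
  finally show "real d * (1 - 4 / 15 * exp (- T) * t) + 3 * sqrt (real d) \<le> ?\<rho>\<^sup>2"
    by (simp add: s_def)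
qed

text \<open>
  The hypotheses on \<open>R\<close> are the two limits of the plateau: the first keeps the slices at least half full,
  the second keeps \<open>exp (- t l\<^sup>2)\<close> above \<open>exp (- 1) \<ge> 1 / 3\<close>. The product \<open>1 / 2 \<cdot> 1 / 3\<close> is the ratio \<open>1 / 6\<close> of
  \<open>plateau_variance\<close>.
\<close>

lemma variance_ge_radius:
  assumes d: "1 \<le> d" and C0: "6 \<le> C0" and a: "0 < a" "a \<le> 3" and b: "0 < b"
    and t: "0 < t" "t \<le> T"
    and \<eta>: "0 \<le> \<eta>" "\<eta> * T \<le> 1 / 2" "2 * \<eta> \<le> 4 / 15 * exp (- T)"
    and R: "0 < R" "C0 * (sqrt b * R) \<le> \<eta> * t * sqrt (real d)" "t * R\<^sup>2 \<le> 1"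
  shows "R\<^sup>2 / 18 \<le> prob_space.variance (gibbs_measure C0 d a b t) (\<lambda>(x, l). l)"
proof -
  define Z where "Z = cube_mass d a t"
  have Z: "0 < Z" unfolding Z_def by (rule cube_mass_pos[OF a(1)])
  have slice: "ennreal (Z / 2) \<le> slice C0 d a b t l" if "\<bar>l\<bar> \<le> R" for l
    unfolding Z_def
  proof (rule tilted_slice_ge[OF d C0 a t \<eta>])
    have "C0 * (sqrt b * \<bar>l\<bar>) \<le> C0 * (sqrt b * R)"
      using that C0 b by (intro mult_left_mono) auto
    then show "C0 * (sqrt b * \<bar>l\<bar>) \<le> \<eta> * t * sqrt (real d)" using R by linarith
  qed
  have tot: "0 < gibbs_total C0 d a b t" "gibbs_total C0 d a b t < \<infinity>"
    using gibbs_total_pos[OF R(1) _ slice] gibbs_total_finite[OF a(1) b, of C0 t d] t C0 Z by auto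
  define n where "n = enn2real (gibbs_total C0 d a b t)"
  have n: "0 < n" using tot by (simp add: n_def enn2real_positive_iff)
  let ?g = "axial_density C0 d a b t"
  have "R\<^sup>2 / 18 \<le> prob_space.variance (density lborel ?g) (\<lambda>l. l)"
  proof (rule plateau_variance[where z = "Z / n" and L = "(sqrt (real d) / C0 + 1) / sqrt b"])
    show "prob_space (density lborel ?g)" by (rule prob_space_axial_density[OF a(1) tot])
    show "?g (- l) = ?g l" for l by (simp add: axial_density_def slice_uminus)
    show "?g l = 0" if "(sqrt (real d) / C0 + 1) / sqrt b < \<bar>l\<bar>" for l
      using that a b C0 by (intro axial_density_support) auto
    fix l assume l: "\<bar>l\<bar> \<le> R"
    have up: "enn2real (slice C0 d a b t l) \<le> Z"
      using slice_le[OF a(1)] Z by (intro enn2real_leI) (auto simp: Z_def)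
    have "enn2real (ennreal (Z / 2)) \<le> enn2real (slice C0 d a b t l)"
      using slice[OF l] slice_finite[OF a(1)] by (intro enn2real_mono) auto
    then have lo: "Z / 2 \<le> enn2real (slice C0 d a b t l)" using Z by simp
    have "l\<^sup>2 \<le> R\<^sup>2" using l R abs_le_square_iff[of l R] by simp
    then have "t * l\<^sup>2 \<le> t * R\<^sup>2" using t by (intro mult_left_mono) auto
    then have "exp (- 1) \<le> exp (- t * l\<^sup>2)" using R by simp
    moreover have "1 / 3 \<le> exp (- 1 :: real)" using exp_le by (simp add: exp_minus field_simps)
    ultimately have e: "1 / 3 \<le> exp (- t * l\<^sup>2)" by linarith
    have "1 / 3 * (Z / 2) \<le> exp (- t * l\<^sup>2) * enn2real (slice C0 d a b t l)"
      using e lo Z by (intro mult_mono) auto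
    from divide_right_mono[OF this, of n] show "Z / n / 6 \<le> ?g l" using n by (simp add: axial_density_def n_def)
    have "exp (- t * l\<^sup>2) * enn2real (slice C0 d a b t l) \<le> 1 * Z"
      using up t by (intro mult_mono) auto
    from divide_right_mono[OF this, of n] show "?g l \<le> Z / n" using n by (simp add: axial_density_def n_def)
  qed (use R in \<open>auto simp: axial_density_nonneg\<close>)
  then show ?thesis by (simp add: variance_snd_gibbs_measure[OF a(1) tot])
qed

text \<open>
  The radius is \<open>R = \<delta> min (t sqrt d) (1 / sqrt t)\<close>. The factor \<open>\<delta> \<le> \<eta> / (C0 sqrt B)\<close> turns the bound \<open>B\<close> on the
  axial variance of the uniform law into the first condition of \<open>variance_ge_radius\<close>.
\<close>

lemma var_Lambda_ge_min:
  assumes C0: "6 \<le> C0" and T: "0 < T"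
  shows "\<exists>c>0. \<forall>d\<ge>(1::nat). \<forall>t. 0 < t \<and> t \<le> T \<longrightarrow> c * min (t\<^sup>2 * real d) (1 / t) \<le> var_Lambda C0 d t"
proof -
  define B where "B = 8 * exp (9 / 8 + C0)"
  have B: "0 < B" by (simp add: B_def)
  define \<eta> where "\<eta> = min (1 / (2 * T)) (2 / 15 * exp (- T))"
  have \<eta>: "0 < \<eta>" "\<eta> * T \<le> 1 / 2" "2 * \<eta> \<le> 4 / 15 * exp (- T)"
  proof -
    have "\<eta> * T \<le> 1 / (2 * T) * T" using T by (intro mult_right_mono) (auto simp: \<eta>_def)
    then show "\<eta> * T \<le> 1 / 2" using T by simp
  qed (use T in \<open>auto simp: \<eta>_def\<close>)
  define \<delta> where "\<delta> = min 1 (\<eta> / (C0 * sqrt B))"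
  have \<delta>: "0 < \<delta>" "\<delta> \<le> 1" "C0 * sqrt B * \<delta> \<le> \<eta>"
  proof -
    have "C0 * sqrt B * \<delta> \<le> C0 * sqrt B * (\<eta> / (C0 * sqrt B))"
      using C0 B by (intro mult_left_mono) (auto simp: \<delta>_def)
    then show "C0 * sqrt B * \<delta> \<le> \<eta>" using C0 B by simp
  qed (use C0 B \<eta> in \<open>auto simp: \<delta>_def\<close>)
  show ?thesis
  proof (intro exI[of _ "\<delta>\<^sup>2 / 18"] conjI allI impI)
    fix d :: nat and t :: real assume d: "1 \<le> d" and "0 < t \<and> t \<le> T"
    then have t: "0 < t" "t \<le> T" by auto
    define m where "m = min (t\<^sup>2 * real d) (1 / t)"
    have m: "0 < m" using t d by (simp add: m_def)
    define R where "R = \<delta> * sqrt m"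
    have R2: "R\<^sup>2 = \<delta>\<^sup>2 * m" using m by (simp add: R_def power_mult_distrib)
    note x = var_x_bounds[OF d C0]
    note l = var_l_bounds[OF d C0, folded B_def]
    have "R\<^sup>2 / 18 \<le> prob_space.variance (gibbs_measure C0 d (var_x C0 d) (var_l C0 d) t) (\<lambda>(x, l). l)"
    proof (rule variance_ge_radius[OF d C0 x l(1) t _ \<eta>(2,3)])
      show "0 < R" using \<delta> m by (simp add: R_def)
      have "sqrt m \<le> sqrt (t\<^sup>2 * real d)" by (simp add: m_def)
      also have "\<dots> = t * sqrt (real d)" using t by (simp add: real_sqrt_mult)
      finally have sm: "sqrt m \<le> t * sqrt (real d)" .
      have "C0 * (sqrt (var_l C0 d) * R) \<le> C0 * (sqrt B * R)"
        using l C0 \<open>0 < R\<close> by (intro mult_left_mono mult_right_mono) auto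
      also have "\<dots> = (C0 * sqrt B * \<delta>) * sqrt m" by (simp add: R_def)
      also have "\<dots> \<le> \<eta> * (t * sqrt (real d))"
        using \<delta> \<eta> sm m by (intro mult_mono) auto
      finally show "C0 * (sqrt (var_l C0 d) * R) \<le> \<eta> * t * sqrt (real d)" by simp
      have "\<delta>\<^sup>2 * (t * m) \<le> 1 * 1"
        using \<delta> t m mult_left_mono[of m "1 / t" t]
        by (intro mult_mono) (auto simp: m_def power_le_one)
      then show "t * R\<^sup>2 \<le> 1" by (simp add: R2 mult.left_commute)
    qed (use \<eta> in auto)
    then show "\<delta>\<^sup>2 / 18 * min (t\<^sup>2 * real d) (1 / t) \<le> var_Lambda C0 d t"
      unfolding var_Lambda_def mu_eq[OF x(1) l(1)] by (simp add: R2 m_def)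
  qed (use \<delta> in auto)
qed

theorem proposition6p3:
  "\<exists>Cmin>0. \<forall>C0\<ge>Cmin.
     (\<forall>\<alpha>>0. \<forall>\<beta>>0. \<exists>c>0. \<forall>d\<ge>(1::nat). \<forall>t::real.
        \<alpha> * real d powr (-1/3) \<le> t \<and> t \<le> \<beta> * real d powr (-1/3)
        \<longrightarrow> var_Lambda C0 d t \<ge> c * real d powr (1/3)) \<and>
     (\<forall>\<alpha>>0. \<forall>\<beta>>0. \<exists>c>0. \<forall>d\<ge>(1::nat). \<forall>t::real.
        \<alpha> * real d powr (-1/2) \<le> t \<and> t \<le> \<beta> * real d powr (-1/3)
        \<longrightarrow> var_Lambda C0 d t \<ge> c * (t\<^sup>2 * real d)) \<and>
     (\<exists>\<epsilon>>0. \<forall>\<alpha>>0. \<exists>c>0. \<forall>d\<ge>(1::nat). \<forall>t::real.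
        \<alpha> * real d powr (-1/3) \<le> t \<and> t \<le> \<epsilon>
        \<longrightarrow> var_Lambda C0 d t \<ge> c * (1 / t))"
proof (rule exI[of _ 6], rule conjI, simp, intro conjI allI impI)
  \<comment> \<open>Both regimes are governed by \<open>t\<^sup>3 d\<close>, the ratio of \<open>t\<^sup>2 d\<close> and \<open>1 / t\<close>.\<close>
  have cube: "(x * real d powr (-1/3)) ^ 3 * real d = x ^ 3" if "1 \<le> d" for x d
  proof -
    have pow: "(real d powr (-1/3)) ^ 3 = real d powr (- 1)"
      using that by (simp add: powr_power)
    have "(real d powr (-1/3)) ^ 3 * real d = 1"
      unfolding pow using that by (simp add: powr_minus_divide)
    then show ?thesis unfolding power_mult_distrib by (simp only: mult.assoc mult_1_right)
  qed
  have upper: "t \<le> \<beta>" "t ^ 3 * real d \<le> \<beta> ^ 3"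
    if "1 \<le> d" "0 < \<beta>" "0 < t" "t \<le> \<beta> * real d powr (-1/3)" for \<beta> t d
  proof -
    have "real d powr (-1/3) \<le> real d powr 0" using that by (intro powr_mono) auto
    then have "\<beta> * real d powr (-1/3) \<le> \<beta> * 1" using that by (intro mult_left_mono) auto
    then show "t \<le> \<beta>" using that(4) by linarith
    have "t ^ 3 * real d \<le> (\<beta> * real d powr (-1/3)) ^ 3 * real d"
      using that by (intro mult_right_mono power_mono) auto
    then show "t ^ 3 * real d \<le> \<beta> ^ 3" using cube[OF that(1)] by simp
  qed
  have lower: "0 < t" "\<alpha> ^ 3 \<le> t ^ 3 * real d"
    if "1 \<le> d" "0 < \<alpha>" "\<alpha> * real d powr (-1/3) \<le> t" for \<alpha> t d
  proof -
    have pos: "0 < \<alpha> * real d powr (-1/3)" using that by simp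
    then show "0 < t" using that by linarith
    have "(\<alpha> * real d powr (-1/3)) ^ 3 * real d \<le> t ^ 3 * real d"
      using that pos by (intro mult_right_mono power_mono) auto
    then show "\<alpha> ^ 3 \<le> t ^ 3 * real d" using cube[OF that(1)] by simp
  qed
  have sq: "t\<^sup>2 * real d = (t ^ 3 * real d) * (1 / t)" if "0 < t" for t :: real and d
    using that by (simp add: power2_eq_square power3_eq_cube)
  fix C0 :: real assume C0: "6 \<le> C0"
  show "\<exists>c>0. \<forall>d\<ge>(1::nat). \<forall>t::real. \<alpha> * real d powr (-1/2) \<le> t \<and> t \<le> \<beta> * real d powr (-1/3)
        \<longrightarrow> var_Lambda C0 d t \<ge> c * (t\<^sup>2 * real d)" if \<alpha>\<beta>: "0 < \<alpha>" "0 < \<beta>" for \<alpha> \<beta>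
  proof -
    obtain c where c: "0 < c"
      "\<And>d t. 1 \<le> d \<Longrightarrow> 0 < t \<Longrightarrow> t \<le> \<beta> \<Longrightarrow> c * min (t\<^sup>2 * real d) (1 / t) \<le> var_Lambda C0 d t"
      using var_Lambda_ge_min[OF C0 \<alpha>\<beta>(2)] by blast
    define k where "k = min 1 (1 / \<beta> ^ 3)"
    have k: "0 < k" "k \<le> 1" "k * \<beta> ^ 3 \<le> 1"
      using \<alpha>\<beta> mult_right_mono[of k "1 / \<beta> ^ 3" "\<beta> ^ 3"] by (auto simp: k_def)
    show ?thesis
    proof (intro exI[of _ "c * k"] conjI allI impI)
      fix d :: nat and t :: real
      assume d: "1 \<le> d" and t: "\<alpha> * real d powr (-1/2) \<le> t \<and> t \<le> \<beta> * real d powr (-1/3)"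
      have "0 < \<alpha> * real d powr (-1/2)" using \<alpha>\<beta> d by simp
      then have t0: "0 < t" using t by linarith
      note u = upper[OF d \<alpha>\<beta>(2) t0 conjunct2[OF t]]
      have "k * (t\<^sup>2 * real d) \<le> 1 * (t\<^sup>2 * real d)" using k by (intro mult_right_mono) auto
      moreover have "k * (t\<^sup>2 * real d) \<le> 1 / t"
      proof -
        have "k * (t ^ 3 * real d) \<le> k * \<beta> ^ 3" using u k by (intro mult_left_mono) auto
        then have "k * (t ^ 3 * real d) \<le> 1" using k(3) by linarith
        then have "k * (t ^ 3 * real d) * (1 / t) \<le> 1 * (1 / t)"
          using t0 by (intro mult_right_mono) auto
        then show ?thesis unfolding sq[OF t0] by (simp only: mult.assoc mult_1)
      qed
      ultimately have "c * (k * (t\<^sup>2 * real d)) \<le> c * min (t\<^sup>2 * real d) (1 / t)"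
        using c by (intro mult_left_mono) auto
      also have "\<dots> \<le> var_Lambda C0 d t" by (rule c(2)[OF d t0 u(1)])
      finally show "c * k * (t\<^sup>2 * real d) \<le> var_Lambda C0 d t" by (simp only: mult.assoc)
    qed (use c k in simp)
  qed
  have inverse_t: "\<exists>c>0. \<forall>d\<ge>(1::nat). \<forall>t::real. \<alpha> * real d powr (-1/3) \<le> t \<and> t \<le> T
        \<longrightarrow> var_Lambda C0 d t \<ge> c * (1 / t)" if \<alpha>T: "0 < \<alpha>" "0 < T" for \<alpha> T
  proof -
    obtain c where c: "0 < c"
      "\<And>d t. 1 \<le> d \<Longrightarrow> 0 < t \<Longrightarrow> t \<le> T \<Longrightarrow> c * min (t\<^sup>2 * real d) (1 / t) \<le> var_Lambda C0 d t"
      using var_Lambda_ge_min[OF C0 \<alpha>T(2)] by blast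
    define k where "k = min 1 (\<alpha> ^ 3)"
    have k: "0 < k" "k \<le> 1" "k \<le> \<alpha> ^ 3" using \<alpha>T by (auto simp: k_def)
    show ?thesis
    proof (intro exI[of _ "c * k"] conjI allI impI)
      fix d :: nat and t :: real
      assume d: "1 \<le> d" and t: "\<alpha> * real d powr (-1/3) \<le> t \<and> t \<le> T"
      note u = lower[OF d \<alpha>T(1) conjunct1[OF t]]
      have "k * (1 / t) \<le> 1 * (1 / t)" using k u by (intro mult_right_mono) auto
      moreover have "k * (1 / t) \<le> t\<^sup>2 * real d"
        unfolding sq[OF u(1)] using k u by (intro mult_right_mono) auto
      ultimately have "c * (k * (1 / t)) \<le> c * min (t\<^sup>2 * real d) (1 / t)"
        using c by (intro mult_left_mono) auto
      also have "\<dots> \<le> var_Lambda C0 d t" by (rule c(2)[OF d u(1) conjunct2[OF t]])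
      finally show "c * k * (1 / t) \<le> var_Lambda C0 d t" by (simp only: mult.assoc)
    qed (use c k in simp)
  qed
  show "\<exists>\<epsilon>>0. \<forall>\<alpha>>0. \<exists>c>0. \<forall>d\<ge>(1::nat). \<forall>t::real. \<alpha> * real d powr (-1/3) \<le> t \<and> t \<le> \<epsilon>
        \<longrightarrow> var_Lambda C0 d t \<ge> c * (1 / t)"
    by (rule exI[of _ 1], intro conjI zero_less_one allI impI, rule inverse_t) auto
  show "\<exists>c>0. \<forall>d\<ge>(1::nat). \<forall>t::real. \<alpha> * real d powr (-1/3) \<le> t \<and> t \<le> \<beta> * real d powr (-1/3)
        \<longrightarrow> var_Lambda C0 d t \<ge> c * real d powr (1/3)" if \<alpha>\<beta>: "0 < \<alpha>" "0 < \<beta>" for \<alpha> \<beta>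
  proof -
    obtain c where c: "0 < c" "\<And>d t. 1 \<le> d \<Longrightarrow> \<alpha> * real d powr (-1/3) \<le> t \<Longrightarrow> t \<le> \<beta>
        \<Longrightarrow> c * (1 / t) \<le> var_Lambda C0 d t"
      using inverse_t[OF \<alpha>\<beta>] by blast
    show ?thesis
    proof (intro exI[of _ "c / \<beta>"] conjI allI impI)
      fix d :: nat and t :: real
      assume d: "1 \<le> d" and t: "\<alpha> * real d powr (-1/3) \<le> t \<and> t \<le> \<beta> * real d powr (-1/3)"
      note t0 = lower(1)[OF d \<alpha>\<beta>(1) conjunct1[OF t]]
      have "c / \<beta> * real d powr (1/3) = c * (1 / (\<beta> * real d powr (-1/3)))"
        by (simp add: powr_minus_divide)
      also have "\<dots> \<le> c * (1 / t)"
        using c t t0 by (intro mult_left_mono divide_left_mono) (auto intro: mult_pos_pos order_less_le_trans)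
      also have "\<dots> \<le> var_Lambda C0 d t"
        by (rule c(2)[OF d conjunct1[OF t] upper(1)[OF d \<alpha>\<beta>(2) t0 conjunct2[OF t]]])
      finally show "c / \<beta> * real d powr (1/3) \<le> var_Lambda C0 d t" .
    qed (use c \<alpha>\<beta> in simp)
  qed
qed

end
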